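(* Let $G_1,G_2$ be two projectively equivalent sprays on an $n$-dimensional smooth manifold $M$, $n\ge2$, both with vanishing $\chi$-curvature. Then $G_1$ is of isotropic curvature if and only if $G_2$ is of isotropic curvature. In particular, if a spray $G$ on $M$ is locally projectively flat and has $\chi=0$, then $G$ is of isotropic curvature.
   Context: Summation over repeated indices is used. $(x^i,y^i)$ denotes standard local coordinates on $TM$; $TM\setminus 0$ is the set of non-zero tangent vectors. A spray $G$ on $M$ is a vector field on $TM\setminus 0$ locally of the form $G = y^i\frac{\partial}{\partial x^i} - 2G^i\frac{\partial}{\partial y^i}$, where the $G^i=G^i(x,y)$ (the spray coefficients) are local $C^\infty$ functions on non-zero vectors with $G^i(x,\lambda y)=\lambda^2 G^i(x,y)$ for all $\lambda>0$. Put $N^i_j=\frac{\partial G^i}{\partial y^j}$, $\Gamma^i_{jk}=\frac{\partial^2 G^i}{\partial y^j\partial y^k}$, $\frac{\delta}{\delta x^k}=\frac{\partial}{\partial x^k}-N^m_k\frac{\partial}{\partial y^m}$. The Riemann curvature tensor is $R^{\ i}_{j\ kl} = \frac{\delta\Gamma^i_{jl}}{\delta x^k}-\frac{\delta\Gamma^i_{jk}}{\delta x^l}+\Gamma^i_{ks}\Gamma^s_{jl}-\Gamma^s_{jk}\Gamma^i_{ls}$, and $R^i_{\ k}=y^jR^{\ i}_{j\ kl}y^l$. Put $R=\frac{1}{n-1}R^m_{\ m}$. A subscript $\cdot k$ denotes $\frac{\partial}{\partial y^k}$. The $\chi$-curvature of $G$ is $\chi_k = -\frac16\{2R^m_{\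 k\cdot m}+R^m_{\ m\cdot k}\}$. $G$ is of isotropic curvature if $R^i_{\ k}=R\,\delta^i_{\ k}-\frac12R_{\cdot k}y^i$. Two sprays $G_1,G_2$ on $M$ are projectively equivalent if $G_1^i=G_2^i+Py^i$ for a scalar function $P$ on $TM\setminus0$, smooth and positively homogeneous of degree one in $y$. A spray is locally projectively flat if around every point there is a local coordinate system in which $G^i=Py^i$ for such a (local) function $P$, i.e. it is projectively equivalent there to the flat spray $y^i\frac{\partial}{\partial x^i}$. *)

theory Defs
  imports "HOL-Analysis.Analysis"
begin

section \<open>Smooth maps between open subsets of Euclidean spaces\<close>

primrec Ck_on :: "nat \<Rightarrow> 'a::euclidean_space set \<Rightarrow> ('a \<Rightarrow> 'b::euclidean_space) \<Rightarrow> bool" where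
  "Ck_on 0 S f \<longleftrightarrow> continuous_on S f"
| "Ck_on (Suc k) S f \<longleftrightarrow>
     (\<forall>x\<in>S. f differentiable (at x)) \<and>
     (\<forall>v. Ck_on k S (\<lambda>x. frechet_derivative f (at x) v))"

text \<open>Only used for open \<open>S\<close>; values of \<open>f\<close> outside \<open>S\<close> are then irrelevant.\<close>

definition smooth_on :: "'a::euclidean_space set \<Rightarrow> ('a \<Rightarrow> 'b::euclidean_space) \<Rightarrow> bool" where
  "smooth_on S f \<longleftrightarrow> (\<forall>k. Ck_on k S f)"

section \<open>Smooth manifolds\<close>

text \<open>A chart is a domain together with a coordinate map, whose values outside the domain
  are irrelevant.\<close>

type_synonym ('a, 'e) chart = "'a set \<times> ('a \<Rightarrow> 'e)"

abbreviation chart_dom :: "('a, 'e) chart \<Rightarrow> 'a set" where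
  "chart_dom c \<equiv> fst c"

abbreviation chart_map :: "('a, 'e) chart \<Rightarrow> 'a \<Rightarrow> 'e" where
  "chart_map c \<equiv> snd c"

definition chart_image :: "('a, 'e) chart \<Rightarrow> 'e set" where
  "chart_image c = chart_map c ` chart_dom c"

definition chart_inv :: "('a, 'e) chart \<Rightarrow> 'e \<Rightarrow> 'a" where
  "chart_inv c = inv_into (chart_dom c) (chart_map c)"

definition transition :: "('a, 'e) chart \<Rightarrow> ('a, 'e) chart \<Rightarrow> 'e \<Rightarrow> 'e" where
  "transition c d = chart_map d \<circ> chart_inv c"

definition is_chart :: "'a topology \<Rightarrow> ('a, 'e::euclidean_space) chart \<Rightarrow> bool" where
  "is_chart M c \<longleftrightarrow>
     openin M (chart_dom c) \<and> open (chart_image c) \<and>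
     homeomorphic_map (subtopology M (chart_dom c)) (top_of_set (chart_image c)) (chart_map c)"

definition smoothly_compatible ::
  "('a, 'e::euclidean_space) chart \<Rightarrow> ('a, 'e) chart \<Rightarrow> bool" where
  "smoothly_compatible c d \<longleftrightarrow>
     smooth_on (chart_map c ` (chart_dom c \<inter> chart_dom d)) (transition c d) \<and>
     smooth_on (chart_map d ` (chart_dom c \<inter> chart_dom d)) (transition d c)"

text \<open>The smooth structure is given by its maximal atlas, so that the members of \<open>A\<close> are
  exactly the local coordinate systems of the manifold.\<close>

definition smooth_manifold :: "'a topology \<Rightarrow> ('a, 'e::euclidean_space) chart set \<Rightarrow> bool" where
  "smooth_manifold M A \<longleftrightarrow>
     Hausdorff_space M \<and> second_countable M \<and>
     (\<forall>c\<in>A. is_chart M c) \<and> (\<Union>c\<in>A. chart_dom c) = topspace M \<and>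
     (\<forall>c\<in>A. \<forall>d\<in>A. smoothly_compatible c d) \<and>
     (\<forall>c. is_chart M c \<and> (\<forall>d\<in>A. smoothly_compatible c d) \<longrightarrow> c \<in> A)"

section \<open>Tangent vectors and vector fields\<close>

text \<open>A tangent vector at \<open>p\<close> is the family of its coordinate vectors in all charts around \<open>p\<close>,
  related by the Jacobians of the coordinate changes. Normalising it to zero on the
  remaining charts makes equality of tangent vectors the intended one, and makes the vector
  space operations pointwise.\<close>

type_synonym ('a, 'e) tvec = "('a, 'e) chart \<Rightarrow> 'e"

definition tangent_space ::
  "('a, 'e::euclidean_space) chart set \<Rightarrow> 'a \<Rightarrow> ('a, 'e) tvec set" where
  "tangent_space A p = {v.
     (\<forall>c\<in>A. \<forall>d\<in>A. p \<in> chart_dom c \<longrightarrow> p \<in> chart_dom d \<longrightarrow>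
        v d = frechet_derivative (transition c d) (at (chart_map c p)) (v c)) \<and>
     (\<forall>c. c \<notin> A \<or> p \<notin> chart_dom c \<longrightarrow> v c = 0)}"

definition smooth_vector_field ::
  "('a, 'e::euclidean_space) chart set \<Rightarrow> ('a \<Rightarrow> ('a, 'e) tvec) \<Rightarrow> bool" where
  "smooth_vector_field A X \<longleftrightarrow>
     (\<forall>p \<in> (\<Union>c\<in>A. chart_dom c). X p \<in> tangent_space A p) \<and>
     (\<forall>c\<in>A. smooth_on (chart_image c) (\<lambda>z. X (chart_inv c z) c))"

section \<open>The slit tangent bundle\<close>

definition slit_tangent_bundle ::
  "('a, 'e::euclidean_space) chart set \<Rightarrow> ('a \<times> ('a, 'e) tvec) set" where
  "slit_tangent_bundle A =
     {(p, v). p \<in> (\<Union>c\<in>A. chart_dom c) \<and> v \<in> tangent_space A p \<and> v \<noteq> (\<lambda>_. 0)}"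

text \<open>The standard local coordinates \<open>(x, y)\<close> induced on non-zero tangent vectors.\<close>

definition slit_chart ::
  "('a, 'e::euclidean_space) chart set \<Rightarrow> ('a, 'e) chart \<Rightarrow>
     ('a \<times> ('a, 'e) tvec, 'e \<times> 'e) chart" where
  "slit_chart A c =
     ({(p, v) \<in> slit_tangent_bundle A. p \<in> chart_dom c}, \<lambda>(p, v). (chart_map c p, v c))"

definition slit_atlas ::
  "('a, 'e::euclidean_space) chart set \<Rightarrow> ('a \<times> ('a, 'e) tvec, 'e \<times> 'e) chart set" where
  "slit_atlas A = slit_chart A ` A"

definition slit_region :: "('a, 'e::euclidean_space) chart \<Rightarrow> ('e \<times> 'e) set" where
  "slit_region c = chart_image c \<times> (- {0})"

lemma chart_inv_chart_map:
  assumes "is_chart M c" "p \<in> chart_dom c"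
  shows "chart_inv c (chart_map c p) = p"
proof -
  have "topspace (subtopology M (chart_dom c)) = chart_dom c"
    using assms openin_subset[of M "chart_dom c"] by (auto simp: is_chart_def)
  then have "inj_on (chart_map c) (chart_dom c)"
    using assms by (metis is_chart_def homeomorphic_imp_injective_map)
  then show ?thesis
    using assms by (simp add: chart_inv_def)
qed

lemma open_chart_overlap:
  assumes "is_chart M c" "is_chart M d"
  shows "open (chart_map c ` (chart_dom c \<inter> chart_dom d))"
proof -
  have "open_map (subtopology M (chart_dom c)) (top_of_set (chart_image c)) (chart_map c)"
    using assms by (simp add: is_chart_def homeomorphic_imp_open_map)
  moreover have "openin (subtopology M (chart_dom c)) (chart_dom c \<inter> chart_dom d)"
    using assms by (auto simp: is_chart_def openin_subtopology)
  ultimately have "openin (top_of_set (chart_image c)) (chart_map c ` (chart_dom c \<inter> chart_dom d))"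
    unfolding open_map_def by blast
  then show ?thesis
    using assms by (auto simp: is_chart_def openin_open)
qed

lemma transition_differentiable:
  assumes "smooth_manifold M A" "c \<in> A" "d \<in> A" "p \<in> chart_dom c" "p \<in> chart_dom d"
  shows "transition c d differentiable (at (chart_map c p))"
proof -
  have "smooth_on (chart_map c ` (chart_dom c \<inter> chart_dom d)) (transition c d)"
    using assms unfolding smooth_manifold_def smoothly_compatible_def by blast
  then have "Ck_on (Suc 0) (chart_map c ` (chart_dom c \<inter> chart_dom d)) (transition c d)"
    unfolding smooth_on_def by blast
  then show ?thesis
    using assms by auto
qed

lemma transition_self_derivative:
  assumes "smooth_manifold M A" "c \<in> A" "p \<in> chart_dom c"
  shows "frechet_derivative (transition c c) (at (chart_map c p)) = (\<lambda>y. y)"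
proof -
  have c: "is_chart M c" using assms unfolding smooth_manifold_def by blast+
  have "((\<lambda>y. y) has_derivative (\<lambda>y. y)) (at (chart_map c p))"
    by (rule has_derivative_ident)
  then have "(transition c c has_derivative (\<lambda>y. y)) (at (chart_map c p))"
    by (rule has_derivative_transform_within_open[of _ _ _ UNIV "chart_image c"])
       (use c assms chart_inv_chart_map[OF c] in
         \<open>auto simp: is_chart_def chart_image_def transition_def\<close>)
  then show ?thesis
    by (metis frechet_derivative_at)
qed

lemma transition_derivative_cocycle:
  assumes "smooth_manifold M A" "c \<in> A" "d \<in> A" "e \<in> A"
    and "p \<in> chart_dom c" "p \<in> chart_dom d" "p \<in> chart_dom e"
  shows "frechet_derivative (transition d e) (at (chart_map d p))
           (frechet_derivative (transition c d) (at (chart_map c p)) y)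
         = frechet_derivative (transition c e) (at (chart_map c p)) y"
proof -
  let ?S = "chart_map c ` (chart_dom c \<inter> chart_dom d)"
  have ch: "is_chart M c" "is_chart M d" using assms unfolding smooth_manifold_def by blast+
  have cp: "transition c d (chart_map c p) = chart_map d p"
    using chart_inv_chart_map[OF ch(1)] assms by (simp add: transition_def)
  have 1: "(transition c d has_derivative frechet_derivative (transition c d) (at (chart_map c p)))
            (at (chart_map c p))"
    by (intro frechet_derivative_works[THEN iffD1] transition_differentiable[OF assms(1)] assms)
  have 2: "(transition d e has_derivative frechet_derivative (transition d e) (at (chart_map d p)))
            (at (transition c d (chart_map c p)))"
    unfolding cp
    by (intro frechet_derivative_works[THEN iffD1] transition_differentiable[OF assms(1)] assms)
  have "((transition d e \<circ> transition c d) has_derivative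
          (frechet_derivative (transition d e) (at (chart_map d p)) \<circ>
           frechet_derivative (transition c d) (at (chart_map c p)))) (at (chart_map c p))"
    using diff_chain_at[OF 1 2] .
  then have "(transition c e has_derivative
          (frechet_derivative (transition d e) (at (chart_map d p)) \<circ>
           frechet_derivative (transition c d) (at (chart_map c p)))) (at (chart_map c p))"
    by (rule has_derivative_transform_within_open[of _ _ _ UNIV ?S])
       (use open_chart_overlap[OF ch] assms
          chart_inv_chart_map[OF ch(1)] chart_inv_chart_map[OF ch(2)] in
         \<open>auto simp: transition_def\<close>)
  then show ?thesis
    by (metis frechet_derivative_at comp_apply)
qed

text \<open>Every pair \<open>(x, y)\<close> with \<open>x\<close> in the image of \<open>c\<close> and \<open>y \<noteq> 0\<close> is the pair of coordinates
  of exactly one non-zero tangent vector over the domain of \<open>c\<close>, so that \<open>chart_inv (slit_chart A c)\<close>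
  may be used freely on \<open>slit_region c\<close>.\<close>

lemma bij_betw_slit_chart:
  assumes M: "smooth_manifold M A" and c: "c \<in> A"
  shows "bij_betw (chart_map (slit_chart A c)) (chart_dom (slit_chart A c)) (slit_region c)"
proof -
  have ch: "is_chart M c" using assms unfolding smooth_manifold_def by blast+
  have eqI: "v = w" if v: "v \<in> tangent_space A p" and w: "w \<in> tangent_space A p"
    and p: "p \<in> chart_dom c" and eq: "v c = w c" for v w p
  proof
    fix d
    show "v d = w d"
    proof (cases "d \<in> A \<and> p \<in> chart_dom d")
      case True
      then have "v d = frechet_derivative (transition c d) (at (chart_map c p)) (v c)"
        "w d = frechet_derivative (transition c d) (at (chart_map c p)) (w c)"
        using v w p c unfolding tangent_space_def by blast+
      then show ?thesis using eq by simp
    next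
      case False
      then have "v d = 0" "w d = 0" using v w unfolding tangent_space_def by blast+
      then show ?thesis by simp
    qed
  qed
  have zero: "(\<lambda>_. 0) \<in> tangent_space A p" for p
  proof -
    have "frechet_derivative (transition a d) (at (chart_map a p)) 0 = 0"
      if "a \<in> A" "d \<in> A" "p \<in> chart_dom a" "p \<in> chart_dom d" for a d
      by (rule linear_0[OF linear_frechet_derivative[OF transition_differentiable[OF M that]]])
    then show ?thesis by (auto simp: tangent_space_def)
  qed
  have "inj_on (chart_map (slit_chart A c)) (chart_dom (slit_chart A c))"
  proof (rule inj_onI, clarsimp simp: slit_chart_def slit_tangent_bundle_def)
    fix p v q w
    assume *: "v \<in> tangent_space A p" "w \<in> tangent_space A q" "p \<in> chart_dom c" "q \<in> chart_dom c"
      "chart_map c p = chart_map c q" "v c = w c"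
    have "p = q" using * chart_inv_chart_map[OF ch] by metis
    then show "p = q \<and> v = w" using * eqI by blast
  qed
  moreover have "chart_map (slit_chart A c) ` chart_dom (slit_chart A c) = slit_region c"
  proof (intro set_eqI iffI)
    fix z assume "z \<in> chart_map (slit_chart A c) ` chart_dom (slit_chart A c)"
    then obtain p v where *: "v \<in> tangent_space A p" "v \<noteq> (\<lambda>_. 0)" "p \<in> chart_dom c"
      "z = (chart_map c p, v c)"
      by (auto simp: slit_chart_def slit_tangent_bundle_def)
    then have "v c \<noteq> 0" using eqI[OF _ zero] by blast
    then show "z \<in> slit_region c" using * by (simp add: slit_region_def chart_image_def)
  next
    fix z assume "z \<in> slit_region c"
    then obtain p y where p: "p \<in> chart_dom c" and y: "y \<noteq> 0" and z: "z = (chart_map c p, y)"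
      by (auto simp: slit_region_def chart_image_def)
    define v where "v d = (if d \<in> A \<and> p \<in> chart_dom d
        then frechet_derivative (transition c d) (at (chart_map c p)) y else 0)" for d
    have vc: "v c = y" using transition_self_derivative[OF M c p] p c by (simp add: v_def)
    have "v \<in> tangent_space A p"
      unfolding tangent_space_def
      using transition_derivative_cocycle[OF M c _ _ p] by (auto simp: v_def)
    moreover have "v \<noteq> (\<lambda>_. 0)" using vc y by auto
    ultimately have "(p, v) \<in> chart_dom (slit_chart A c)"
      using p c unfolding slit_chart_def slit_tangent_bundle_def by auto
    then show "z \<in> chart_map (slit_chart A c) ` chart_dom (slit_chart A c)"
      using vc z by (force simp: slit_chart_def)
  qed
  ultimately show ?thesis by (simp add: bij_betw_def)
qed

section \<open>Sprays\<close>

type_synonym ('a, 'e) spray_field =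
  "'a \<times> ('a, 'e) tvec \<Rightarrow> ('a \<times> ('a, 'e) tvec, 'e \<times> 'e) tvec"

text \<open>The \<open>G\<^sup>i\<close> read off from the components \<open>- 2 G\<^sup>i\<close> along \<open>\<partial>/\<partial>y\<^sup>i\<close>, as a function of \<open>(x, y)\<close>.\<close>

definition spray_coeff ::
  "('a, 'e::euclidean_space) chart set \<Rightarrow> ('a, 'e) spray_field \<Rightarrow> ('a, 'e) chart \<Rightarrow>
     'e \<times> 'e \<Rightarrow> 'e" where
  "spray_coeff A X c z =
     (- 1 / 2) *\<^sub>R snd (X (chart_inv (slit_chart A c) z) (slit_chart A c))"

definition pos_homogeneous ::
  "('a, 'e::euclidean_space) chart \<Rightarrow> nat \<Rightarrow> ('e \<times> 'e \<Rightarrow> 'b::real_vector) \<Rightarrow> bool" where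
  "pos_homogeneous c k f \<longleftrightarrow>
     (\<forall>(x, y) \<in> slit_region c. \<forall>t>0. f (x, t *\<^sub>R y) = t ^ k *\<^sub>R f (x, y))"

definition is_spray ::
  "('a, 'e::euclidean_space) chart set \<Rightarrow> ('a, 'e) spray_field \<Rightarrow> bool" where
  "is_spray A X \<longleftrightarrow>
     smooth_vector_field (slit_atlas A) X \<and>
     (\<forall>c\<in>A.
        (\<forall>(x, y) \<in> slit_region c.
           X (chart_inv (slit_chart A c) (x, y)) (slit_chart A c)
             = (y, - 2 *\<^sub>R spray_coeff A X c (x, y))) \<and>
        smooth_on (slit_region c) (spray_coeff A X c) \<and>
        pos_homogeneous c 2 (spray_coeff A X c))"

section \<open>Curvature in local coordinates\<close>

text \<open>Below, \<open>G\<close> stands for the spray coefficients in one chart, as a function of \<open>z = (x, y)\<close>.\<close>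

definition dx :: "'n::finite \<Rightarrow> ((real^'n) \<times> (real^'n) \<Rightarrow> real) \<Rightarrow> (real^'n) \<times> (real^'n) \<Rightarrow> real" where
  "dx i f z = frechet_derivative f (at z) (axis i 1, 0)"

definition dy :: "'n::finite \<Rightarrow> ((real^'n) \<times> (real^'n) \<Rightarrow> real) \<Rightarrow> (real^'n) \<times> (real^'n) \<Rightarrow> real" where
  "dy i f z = frechet_derivative f (at z) (0, axis i 1)"

context
  fixes G :: "(real^'n::finite) \<times> (real^'n) \<Rightarrow> real^'n"
begin

definition N_conn :: "'n \<Rightarrow> 'n \<Rightarrow> (real^'n) \<times> (real^'n) \<Rightarrow> real" where
  "N_conn i j = dy j (\<lambda>z. G z $ i)"

definition Gamma_conn :: "'n \<Rightarrow> 'n \<Rightarrow> 'n \<Rightarrow> (real^'n) \<times> (real^'n) \<Rightarrow> real" where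
  "Gamma_conn i j k = dy j (dy k (\<lambda>z. G z $ i))"

definition horiz_deriv ::
  "'n \<Rightarrow> ((real^'n) \<times> (real^'n) \<Rightarrow> real) \<Rightarrow> (real^'n) \<times> (real^'n) \<Rightarrow> real" where
  "horiz_deriv k f z = dx k f z - (\<Sum>m\<in>UNIV. N_conn m k z * dy m f z)"

text \<open>\<open>Riem i j k l\<close> is the tensor with upper index \<open>i\<close> and lower indices \<open>j k l\<close>.\<close>

definition Riem :: "'n \<Rightarrow> 'n \<Rightarrow> 'n \<Rightarrow> 'n \<Rightarrow> (real^'n) \<times> (real^'n) \<Rightarrow> real" where
  "Riem i j k l z =
     horiz_deriv k (Gamma_conn i j l) z - horiz_deriv l (Gamma_conn i j k) z
     + (\<Sum>s\<in>UNIV. Gamma_conn i k s z * Gamma_conn s j l z)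
     - (\<Sum>s\<in>UNIV. Gamma_conn s j k z * Gamma_conn i l s z)"

definition Riem2 :: "'n \<Rightarrow> 'n \<Rightarrow> (real^'n) \<times> (real^'n) \<Rightarrow> real" where
  "Riem2 i k z = (\<Sum>j\<in>UNIV. \<Sum>l\<in>UNIV. snd z $ j * Riem i j k l z * snd z $ l)"

definition R_scalar :: "(real^'n) \<times> (real^'n) \<Rightarrow> real" where
  "R_scalar z = 1 / (real CARD('n) - 1) * (\<Sum>m\<in>UNIV. Riem2 m m z)"

definition chi_curv :: "'n \<Rightarrow> (real^'n) \<times> (real^'n) \<Rightarrow> real" where
  "chi_curv k z =
     - (1 / 6) * (2 * (\<Sum>m\<in>UNIV. dy m (Riem2 m k) z) + dy k (\<lambda>w. \<Sum>m\<in>UNIV. Riem2 m m w) z)"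

end

section \<open>Properties of sprays\<close>

definition vanishing_chi ::
  "('a, real^'n::finite) chart set \<Rightarrow> ('a, real^'n) spray_field \<Rightarrow> bool" where
  "vanishing_chi A X \<longleftrightarrow>
     (\<forall>c\<in>A. \<forall>z\<in>slit_region c. \<forall>k. chi_curv (spray_coeff A X c) k z = 0)"

definition isotropic_curvature ::
  "('a, real^'n::finite) chart set \<Rightarrow> ('a, real^'n) spray_field \<Rightarrow> bool" where
  "isotropic_curvature A X \<longleftrightarrow>
     (\<forall>c\<in>A. \<forall>z\<in>slit_region c. \<forall>i k.
        let G = spray_coeff A X c in
        Riem2 G i k z
          = R_scalar G z * (if i = k then 1 else 0) - 1 / 2 * dy k (R_scalar G) z * snd z $ i)"

definition projectively_equivalent ::
  "('a, 'e::euclidean_space) chart set \<Rightarrow>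
     ('a, 'e) spray_field \<Rightarrow> ('a, 'e) spray_field \<Rightarrow> bool" where
  "projectively_equivalent A X1 X2 \<longleftrightarrow>
     (\<exists>P :: 'a \<times> ('a, 'e) tvec \<Rightarrow> real.
        (\<forall>(p, v) \<in> slit_tangent_bundle A. \<forall>t>0. P (p, \<lambda>c. t *\<^sub>R v c) = t * P (p, v)) \<and>
        (\<forall>c\<in>A. smooth_on (slit_region c) (\<lambda>z. P (chart_inv (slit_chart A c) z)) \<and>
           (\<forall>(x, y) \<in> slit_region c.
              spray_coeff A X1 c (x, y)
                = spray_coeff A X2 c (x, y) + P (chart_inv (slit_chart A c) (x, y)) *\<^sub>R y)))"

definition locally_projectively_flat ::
  "'a topology \<Rightarrow> ('a, 'e::euclidean_space) chart set \<Rightarrow> ('a, 'e) spray_field \<Rightarrow> bool" where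
  "locally_projectively_flat M A X \<longleftrightarrow>
     (\<forall>p\<in>topspace M. \<exists>c\<in>A. p \<in> chart_dom c \<and>
        (\<exists>P :: 'e \<times> 'e \<Rightarrow> real.
           smooth_on (slit_region c) P \<and> pos_homogeneous c 1 P \<and>
           (\<forall>(x, y) \<in> slit_region c. spray_coeff A X c (x, y) = P (x, y) *\<^sub>R y)))"

end

theory Submission
  imports Defs
begin

text \<open>
  Under a projective change \<open>G' = G + P y\<close> the Riemann curvature becomes
  \<open>R'\<^sup>i\<^sub>k = R\<^sup>i\<^sub>k + E \<delta>\<^sup>i\<^sub>k + \<tau>\<^sub>k y\<^sup>i\<close> with \<open>E\<close> and \<open>\<tau>\<^sub>k\<close> homogeneous of degrees two and one. So if \<open>G\<close> is of
  isotropic curvature, then \<open>R'\<^sup>i\<^sub>k = S \<delta>\<^sup>i\<^sub>k + \<sigma>\<^sub>k y\<^sup>i\<close>. Contracting with \<open>y\<^sup>k\<close> gives \<open>S = - \<sigma>\<^sub>k y\<^sup>k\<close>, hence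
  \<open>R' = S\<close>, and \<open>-6 \<chi>'\<^sub>k = (n + 1) (S\<^sub>\<cdot>\<^sub>k + 2 \<sigma>\<^sub>k)\<close>, so \<open>\<chi>' = 0\<close> forces \<open>\<sigma>\<^sub>k = - S\<^sub>\<cdot>\<^sub>k / 2\<close>.

  If \<open>G = P y\<close> in one chart, then in any overlapping chart \<open>G - P y\<close> is the flat spray in new
  coordinates: \<open>\<partial>\<^sub>i\<psi>\<^sup>a G\<^sub>0\<^sup>i = \<partial>\<^sub>i\<partial>\<^sub>j\<psi>\<^sup>a y\<^sup>i y\<^sup>j / 2\<close> for the coordinate change \<open>\<psi>\<close>. Differentiating this
  identity shows that \<open>G\<^sub>0\<close> has zero curvature, so the first part applies in every chart.
\<close>

section \<open>Smooth maps\<close>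

text \<open>Both functions have the same set of derivatives at \<open>x\<close>, so the choice
  behind \<open>frechet_derivative\<close> selects the same map, even where neither is
  differentiable.\<close>

lemma frechet_derivative_cong_open:
  assumes "open S" "x \<in> S" "\<And>x. x \<in> S \<Longrightarrow> f x = g x"
  shows "frechet_derivative f (at x) = frechet_derivative g (at x)"
proof -
  have "(f has_derivative D) (at x) \<longleftrightarrow> (g has_derivative D) (at x)" for D
    using has_derivative_transform_within_open[of f D x UNIV S g]
      has_derivative_transform_within_open[of g D x UNIV S f] assms by (auto)
  then show ?thesis by (simp add: frechet_derivative_def)
qed

lemma differentiable_cong_open:
  assumes "open S" "x \<in> S" "\<And>x. x \<in> S \<Longrightarrow> f x = g x" "f differentiable (at x)"
  shows "g differentiable (at x)"
  using assms unfolding differentiable_def by (metis has_derivative_transform_within_open)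

text \<open>In the closure rules below a derivative equals its explicit formula only on
  \<open>S\<close>; this lemma carries regularity from the formula to the derivative.\<close>

lemma Ck_on_cong:
  assumes "open S" "\<And>x. x \<in> S \<Longrightarrow> f x = g x" "Ck_on k S f"
  shows "Ck_on k S g"
  using assms
proof (induction k arbitrary: f g)
  case 0
  then show ?case using continuous_on_cong[of S S f g] by (auto dest: sym)
next
  case (Suc k)
  have "Ck_on k S (\<lambda>x. frechet_derivative g (at x) v)" for v
  proof (rule Suc.IH[OF Suc.prems(1)])
    show "frechet_derivative f (at x) v = frechet_derivative g (at x) v" if "x \<in> S" for x
      using frechet_derivative_cong_open[OF Suc.prems(1) that Suc.prems(2)] by simp
    show "Ck_on k S (\<lambda>x. frechet_derivative f (at x) v)"
      using Suc.prems(3) by simp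
  qed
  moreover have "g differentiable (at x)" if "x \<in> S" for x
    by (rule differentiable_cong_open[OF Suc.prems(1) that, of f]) (use Suc.prems that in auto)
  ultimately show ?case by simp
qed

lemma Ck_on_SucD: "Ck_on (Suc k) S f \<Longrightarrow> Ck_on k S f"
proof (induction k arbitrary: f)
  case 0
  then show ?case
    by (auto intro: continuous_at_imp_continuous_on differentiable_imp_continuous_within)
qed auto

lemma Ck_on_const: "Ck_on k S (\<lambda>_. c)"
  by (induction k arbitrary: c) auto

lemma Ck_on_add:
  assumes "open S" "Ck_on k S f" "Ck_on k S g"
  shows "Ck_on k S (\<lambda>x. f x + g x)"
  using assms(2,3)
proof (induction k arbitrary: f g)
  case 0
  then show ?case by (simp add: continuous_on_add)
next
  case (Suc k)
  have der: "((\<lambda>x. f x + g x) has_derivative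
      (\<lambda>v. frechet_derivative f (at x) v + frechet_derivative g (at x) v)) (at x)"
    if "x \<in> S" for x
    using Suc.prems that by (auto intro!: has_derivative_add simp: frechet_derivative_works)
  have "Ck_on k S (\<lambda>x. frechet_derivative (\<lambda>x. f x + g x) (at x) v)" for v
  proof (rule Ck_on_cong[OF assms(1)])
    show "Ck_on k S (\<lambda>x. frechet_derivative f (at x) v + frechet_derivative g (at x) v)"
      using Suc by auto
    show "frechet_derivative f (at x) v + frechet_derivative g (at x) v
        = frechet_derivative (\<lambda>x. f x + g x) (at x) v" if "x \<in> S" for x
      by (rule fun_cong[OF frechet_derivative_at[OF der[OF that]]])
  qed
  then show ?case using der by (auto simp: differentiable_def)
qed

lemma Ck_on_sum:
  assumes "open S" "\<And>i. i \<in> I \<Longrightarrow> Ck_on k S (f i)"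
  shows "Ck_on k S (\<lambda>x. \<Sum>i\<in>I. f i x)"
  using assms(2)
  by (induction I rule: infinite_finite_induct) (auto intro: Ck_on_const Ck_on_add[OF assms(1)])

lemma Ck_on_bounded_linear:
  assumes "open S" "bounded_linear L" "Ck_on k S f"
  shows "Ck_on k S (\<lambda>x. L (f x))"
  using assms(3)
proof (induction k arbitrary: f)
  case 0
  then show ?case using bounded_linear.continuous_on[OF assms(2)] by simp
next
  case (Suc k)
  have der: "((\<lambda>x. L (f x)) has_derivative (\<lambda>v. L (frechet_derivative f (at x) v))) (at x)"
    if "x \<in> S" for x
    using Suc.prems that
    by (auto intro!: bounded_linear.has_derivative[OF assms(2)] simp: frechet_derivative_works)
  have "Ck_on k S (\<lambda>x. frechet_derivative (\<lambda>x. L (f x)) (at x) v)" for v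
  proof (rule Ck_on_cong[OF assms(1)])
    show "Ck_on k S (\<lambda>x. L (frechet_derivative f (at x) v))"
      using Suc by auto
    show "L (frechet_derivative f (at x) v) = frechet_derivative (\<lambda>x. L (f x)) (at x) v"
      if "x \<in> S" for x
      by (rule fun_cong[OF frechet_derivative_at[OF der[OF that]]])
  qed
  then show ?case using der by (auto simp: differentiable_def)
qed

lemma Ck_on_scaleR:
  fixes f :: "'a::euclidean_space \<Rightarrow> real" and g :: "'a \<Rightarrow> 'b::euclidean_space"
  assumes "open S" "Ck_on k S f" "Ck_on k S g"
  shows "Ck_on k S (\<lambda>x. f x *\<^sub>R g x)"
  using assms(2,3)
proof (induction k arbitrary: f g)
  case 0
  then show ?case by (simp add: continuous_on_scaleR)
next
  case (Suc k)
  have der: "((\<lambda>x. f x *\<^sub>R g x) has_derivative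
      (\<lambda>v. f x *\<^sub>R frechet_derivative g (at x) v + frechet_derivative f (at x) v *\<^sub>R g x)) (at x)"
    if "x \<in> S" for x
    using Suc.prems that by (auto intro!: has_derivative_scaleR simp: frechet_derivative_works)
  have "Ck_on k S (\<lambda>x. frechet_derivative (\<lambda>x. f x *\<^sub>R g x) (at x) v)" for v
  proof (rule Ck_on_cong[OF assms(1)])
    show "Ck_on k S (\<lambda>x. f x *\<^sub>R frechet_derivative g (at x) v + frechet_derivative f (at x) v *\<^sub>R g x)"
      \<comment> \<open>The product rule keeps one factor undifferentiated; it is of class
        \<open>Suc k\<close> and is lowered to class \<open>k\<close> before the induction
        hypothesis applies.\<close>
      using Suc.prems by (intro Ck_on_add[OF assms(1)] Suc.IH Ck_on_SucD[of k S f] Ck_on_SucD[of k S g]) auto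
    show "f x *\<^sub>R frechet_derivative g (at x) v + frechet_derivative f (at x) v *\<^sub>R g x
        = frechet_derivative (\<lambda>x. f x *\<^sub>R g x) (at x) v"
      if "x \<in> S" for x
      by (rule fun_cong[OF frechet_derivative_at[OF der[OF that]]])
  qed
  then show ?case using der by (auto simp: differentiable_def)
qed

text \<open>\<open>Ck_on\<close> speaks of derivatives in a fixed direction, whereas the chain rule
  produces a direction that moves with the point. Linearity leaves fixed basis directions with
  scalar coefficients.\<close>

lemma derivative_basis_expansion:
  fixes f :: "'a::euclidean_space \<Rightarrow> 'b::real_normed_vector"
  assumes "f differentiable (at x)"
  shows "frechet_derivative f (at x) v = (\<Sum>b\<in>Basis. (v \<bullet> b) *\<^sub>R frechet_derivative f (at x) b)"
proof -
  interpret linear "frechet_derivative f (at x)"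
    by (rule linear_frechet_derivative[OF assms])
  have "frechet_derivative f (at x) v = frechet_derivative f (at x) (\<Sum>b\<in>Basis. (v \<bullet> b) *\<^sub>R b)"
    by (simp add: euclidean_representation)
  then show ?thesis by (simp only: sum scaleR)
qed

text \<open>Induction on \<open>k\<close> with the inner map fixed: after the basis expansion, the
  derivative is a sum of products of a component of the derivative of \<open>g\<close> with a
  directional derivative of \<open>f\<close> composed with the same \<open>g\<close>.\<close>

lemma Ck_on_compose:
  fixes f :: "'b::euclidean_space \<Rightarrow> 'c::euclidean_space" and g :: "'a::euclidean_space \<Rightarrow> 'b"
  assumes "open S" "Ck_on k T f" "Ck_on k S g" "\<And>x. x \<in> S \<Longrightarrow> g x \<in> T"
  shows "Ck_on k S (\<lambda>x. f (g x))"
  using assms(2,3)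
proof (induction k arbitrary: f)
  case 0
  then show ?case using assms(4) by (auto intro: continuous_on_compose2)
next
  case (Suc k)
  have der: "((\<lambda>x. f (g x)) has_derivative
      (\<lambda>v. \<Sum>b\<in>Basis. (frechet_derivative g (at x) v \<bullet> b) *\<^sub>R frechet_derivative f (at (g x)) b)) (at x)"
    if "x \<in> S" for x
  proof -
    have "f differentiable at (g x)" "g differentiable at x"
      using Suc.prems assms(4) that by auto
    then show ?thesis
      unfolding derivative_basis_expansion[OF \<open>f differentiable at (g x)\<close>, symmetric]
      by (intro has_derivative_compose[of g _ x UNIV f]) (simp_all only: frechet_derivative_works)
  qed
  have "Ck_on k S (\<lambda>x. frechet_derivative (\<lambda>x. f (g x)) (at x) v)" for v
  proof (rule Ck_on_cong[OF assms(1)])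
    show "Ck_on k S (\<lambda>x. \<Sum>b\<in>Basis. (frechet_derivative g (at x) v \<bullet> b) *\<^sub>R frechet_derivative f (at (g x)) b)"
      using Suc.prems
      by (intro Ck_on_sum[OF assms(1)] Ck_on_scaleR[OF assms(1)] Suc.IH
          Ck_on_bounded_linear[OF assms(1) bounded_linear_inner_left] Ck_on_SucD[of k S g]) auto
    show "(\<Sum>b\<in>Basis. (frechet_derivative g (at x) v \<bullet> b) *\<^sub>R frechet_derivative f (at (g x)) b)
        = frechet_derivative (\<lambda>x. f (g x)) (at x) v"
      if "x \<in> S" for x
      by (rule fun_cong[OF frechet_derivative_at[OF der[OF that]]])
  qed
  then show ?case using der by (auto simp: differentiable_def)
qed

lemma Ck_on_ident: "Ck_on k S (\<lambda>x. x)"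
  by (cases k) (auto intro: Ck_on_const)

lemma Ck_on_subset: "Ck_on k T f \<Longrightarrow> S \<subseteq> T \<Longrightarrow> Ck_on k S f"
  by (induction k arbitrary: f) (auto intro: continuous_on_subset)

section \<open>Closure properties of smooth maps\<close>

lemma smooth_on_differentiable: "smooth_on S f \<Longrightarrow> x \<in> S \<Longrightarrow> f differentiable (at x)"
  unfolding smooth_on_def by (metis Ck_on.simps(2))

lemma smooth_on_derivative: "smooth_on S f \<Longrightarrow> smooth_on S (\<lambda>x. frechet_derivative f (at x) v)"
  unfolding smooth_on_def by (metis Ck_on.simps(2))

lemma smooth_on_continuous_on: "smooth_on S f \<Longrightarrow> continuous_on S f"
  unfolding smooth_on_def by (metis Ck_on.simps(1))

lemma smooth_on_subset: "smooth_on T f \<Longrightarrow> S \<subseteq> T \<Longrightarrow> smooth_on S f"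
  unfolding smooth_on_def by (metis Ck_on_subset)

lemma smooth_on_cong:
  "open S \<Longrightarrow> smooth_on S f \<Longrightarrow> (\<And>x. x \<in> S \<Longrightarrow> f x = g x) \<Longrightarrow> smooth_on S g"
  unfolding smooth_on_def by (metis Ck_on_cong)

lemma smooth_on_compose:
  "open S \<Longrightarrow> smooth_on T f \<Longrightarrow> smooth_on S g \<Longrightarrow> (\<And>x. x \<in> S \<Longrightarrow> g x \<in> T)
    \<Longrightarrow> smooth_on S (\<lambda>x. f (g x))"
  unfolding smooth_on_def by (blast intro: Ck_on_compose)

lemma smooth_on_bounded_linear:
  "open S \<Longrightarrow> bounded_linear L \<Longrightarrow> smooth_on S f \<Longrightarrow> smooth_on S (\<lambda>x. L (f x))"
  unfolding smooth_on_def by (simp add: Ck_on_bounded_linear)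

lemma smooth_on_linear: "open S \<Longrightarrow> bounded_linear L \<Longrightarrow> smooth_on S L"
  using smooth_on_bounded_linear[of S L "\<lambda>x. x"] by (simp add: smooth_on_def Ck_on_ident)

lemma smooth_on_const: "smooth_on S (\<lambda>_. c)"
  by (simp add: smooth_on_def Ck_on_const)

lemma smooth_on_add:
  "open S \<Longrightarrow> smooth_on S f \<Longrightarrow> smooth_on S g \<Longrightarrow> smooth_on S (\<lambda>x. f x + g x)"
  unfolding smooth_on_def by (simp add: Ck_on_add)

lemma smooth_on_sum:
  "open S \<Longrightarrow> (\<And>i. i \<in> I \<Longrightarrow> smooth_on S (f i)) \<Longrightarrow> smooth_on S (\<lambda>x. \<Sum>i\<in>I. f i x)"
  unfolding smooth_on_def by (simp add: Ck_on_sum)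

lemma smooth_on_scaleR:
  "open S \<Longrightarrow> smooth_on S f \<Longrightarrow> smooth_on S g \<Longrightarrow> smooth_on S (\<lambda>x. f x *\<^sub>R g x)"
  unfolding smooth_on_def by (simp add: Ck_on_scaleR)

lemma smooth_on_mult:
  fixes f g :: "'a::euclidean_space \<Rightarrow> real"
  shows "open S \<Longrightarrow> smooth_on S f \<Longrightarrow> smooth_on S g \<Longrightarrow> smooth_on S (\<lambda>x. f x * g x)"
  using smooth_on_scaleR[of S f g] by simp

lemma smooth_on_diff:
  assumes "open S" "smooth_on S f" "smooth_on S g"
  shows "smooth_on S (\<lambda>x. f x - g x)"
  using smooth_on_add[OF assms(1,2) smooth_on_bounded_linear[OF assms(1)
        bounded_linear_minus[OF bounded_linear_ident] assms(3)]] by simp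

lemma smooth_on_Pair:
  assumes "open S" "smooth_on S f" "smooth_on S g"
  shows "smooth_on S (\<lambda>x. (f x, g x))"
proof -
  have "smooth_on S (\<lambda>x. (f x, 0) + (0, g x))"
    using assms
    by (intro smooth_on_add smooth_on_bounded_linear[of S "\<lambda>a. (a, 0)"]
        smooth_on_bounded_linear[of S "\<lambda>a. (0, a)"] bounded_linear_Pair
        bounded_linear_ident bounded_linear_zero)
  then show ?thesis by simp
qed

section \<open>Derivative rules and the symmetry of second derivatives\<close>

lemma frechet_derivative_add:
  fixes f g :: "'a::real_normed_vector \<Rightarrow> 'b::real_normed_vector"
  assumes "f differentiable (at z)" "g differentiable (at z)"
  shows "frechet_derivative (\<lambda>w. f w + g w) (at z) v
       = frechet_derivative f (at z) v + frechet_derivative g (at z) v"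
proof -
  have "((\<lambda>w. f w + g w) has_derivative
      (\<lambda>v. frechet_derivative f (at z) v + frechet_derivative g (at z) v)) (at z)"
    using assms by (intro has_derivative_add) (auto simp only: frechet_derivative_works)
  from fun_cong[OF frechet_derivative_at[OF this]] show ?thesis by simp
qed

lemma frechet_derivative_mult:
  fixes f g :: "'a::real_normed_vector \<Rightarrow> 'b::real_normed_algebra"
  assumes "f differentiable (at z)" "g differentiable (at z)"
  shows "frechet_derivative (\<lambda>w. f w * g w) (at z) v
       = f z * frechet_derivative g (at z) v + frechet_derivative f (at z) v * g z"
proof -
  have "((\<lambda>w. f w * g w) has_derivative
      (\<lambda>v. f z * frechet_derivative g (at z) v + frechet_derivative f (at z) v * g z)) (at z)"
    using assms by (intro has_derivative_mult) (auto simp only: frechet_derivative_works)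
  from fun_cong[OF frechet_derivative_at[OF this]] show ?thesis by simp
qed

text \<open>Reduces directional derivatives to one real variable, for the mean value theorem and for
  Euler's identity.\<close>

lemma has_derivative_along_line:
  assumes "f differentiable (at (z + t *\<^sub>R u))"
  shows "((\<lambda>t. f (z + t *\<^sub>R u)) has_real_derivative frechet_derivative f (at (z + t *\<^sub>R u)) u) (at t)"
proof -
  have "((\<lambda>t. f (z + t *\<^sub>R u)) has_derivative
      (\<lambda>s. frechet_derivative f (at (z + t *\<^sub>R u)) (s *\<^sub>R u))) (at t)"
    by (rule has_derivative_compose[of "\<lambda>t. z + t *\<^sub>R u" "\<lambda>s. s *\<^sub>R u"])
       (use assms in \<open>auto intro!: derivative_eq_intros simp: frechet_derivative_works\<close>)
  moreover have "(\<lambda>s. frechet_derivative f (at (z + t *\<^sub>R u)) (s *\<^sub>R u))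
      = (*) (frechet_derivative f (at (z + t *\<^sub>R u)) u)"
    using linear_scale[OF linear_frechet_derivative[OF assms]] by (auto simp: mult.commute)
  ultimately show ?thesis by (simp add: has_field_derivative_def)
qed

text \<open>Both iterated derivatives arise from the same second difference, hence Clairaut's theorem
  below.\<close>

lemma second_difference_mean_value:
  fixes f :: "'a::euclidean_space \<Rightarrow> real"
  assumes f: "smooth_on S f" and h: "h > 0"
    and ball: "\<And>s t. 0 \<le> s \<Longrightarrow> s \<le> h \<Longrightarrow> 0 \<le> t \<Longrightarrow> t \<le> h \<Longrightarrow> z + s *\<^sub>R u + t *\<^sub>R v \<in> S"
  shows "\<exists>s t. 0 \<le> s \<and> s \<le> h \<and> 0 \<le> t \<and> t \<le> h \<and>
    f (z + h *\<^sub>R u + h *\<^sub>R v) - f (z + h *\<^sub>R u) - f (z + h *\<^sub>R v) + f z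
    = h * h * frechet_derivative (\<lambda>x. frechet_derivative f (at x) u)
        (at (z + s *\<^sub>R u + t *\<^sub>R v)) v"
proof -
  let ?Du = "\<lambda>x. frechet_derivative f (at x) u"
  \<comment> \<open>First mean value step: the increment of \<open>f\<close> in direction
    \<open>v\<close> is regarded as a function of the displacement along \<open>u\<close>.\<close>
  have "((\<lambda>s. f (z + h *\<^sub>R v + s *\<^sub>R u) - f (z + s *\<^sub>R u)) has_real_derivative
      ?Du (z + h *\<^sub>R v + s *\<^sub>R u) - ?Du (z + s *\<^sub>R u)) (at s)" if "0 \<le> s" "s \<le> h" for s
    using ball[OF that, of h] ball[OF that, of 0] h
    by (intro DERIV_diff has_derivative_along_line smooth_on_differentiable[OF f])
       (auto simp: algebra_simps)
  from MVT2[OF h this] obtain s where s: "0 < s" "s < h"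
    and s_eq: "f (z + h *\<^sub>R v + h *\<^sub>R u) - f (z + h *\<^sub>R u) - (f (z + h *\<^sub>R v) - f z)
      = h * (?Du (z + h *\<^sub>R v + s *\<^sub>R u) - ?Du (z + s *\<^sub>R u))"
    by auto
  \<comment> \<open>Second mean value step: the derivative along \<open>u\<close> is now followed
    along \<open>v\<close>.\<close>
  have "((\<lambda>t. ?Du (z + s *\<^sub>R u + t *\<^sub>R v)) has_real_derivative
      frechet_derivative ?Du (at (z + s *\<^sub>R u + t *\<^sub>R v)) v) (at t)" if "0 \<le> t" "t \<le> h" for t
    using s ball[of s t] that
    by (intro has_derivative_along_line smooth_on_differentiable[OF smooth_on_derivative[OF f]]) auto
  from MVT2[OF h this] obtain t where t: "0 < t" "t < h"
    and t_eq: "?Du (z + s *\<^sub>R u + h *\<^sub>R v) - ?Du (z + s *\<^sub>R u)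
      = h * frechet_derivative ?Du (at (z + s *\<^sub>R u + t *\<^sub>R v)) v"
    by auto
  show ?thesis
  proof (intro exI conjI)
    show "f (z + h *\<^sub>R u + h *\<^sub>R v) - f (z + h *\<^sub>R u) - f (z + h *\<^sub>R v) + f z
      = h * h * frechet_derivative ?Du (at (z + s *\<^sub>R u + t *\<^sub>R v)) v"
      using s_eq t_eq by (simp add: algebra_simps)
  qed (use s t in auto)
qed

text \<open>The second difference is symmetric in \<open>u\<close> and \<open>v\<close>, so the two
  iterated derivatives take a common value at two points of an arbitrarily small parallelogram.
  Continuity of both at \<open>z\<close> then excludes a gap between their values there.\<close>

lemma clairaut:
  fixes f :: "'a::euclidean_space \<Rightarrow> real"
  assumes "open S" "smooth_on S f" "z \<in> S"
  shows "frechet_derivative (\<lambda>x. frechet_derivative f (at x) u) (at z) v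
       = frechet_derivative (\<lambda>x. frechet_derivative f (at x) v) (at z) u"
proof (rule ccontr)
  let ?D = "\<lambda>u v x. frechet_derivative (\<lambda>x. frechet_derivative f (at x) u) (at x) v"
  assume ne: "?D u v z \<noteq> ?D v u z"
  \<comment> \<open>Half of the supposed gap: two errors, each below \<open>e\<close>, cannot bridge
    it.\<close>
  define e where "e = \<bar>?D u v z - ?D v u z\<bar> / 2"
  have e: "e > 0" using ne by (simp add: e_def)
  have cont: "isCont (?D u v) z" for u v
    using assms by (intro continuous_on_interior[OF smooth_on_continuous_on]
        smooth_on_derivative) (auto simp: interior_open)
  obtain d1 where d1: "d1 > 0" "\<And>x. dist x z < d1 \<Longrightarrow> \<bar>?D u v x - ?D u v z\<bar> < e"
    using cont[of u v] e unfolding continuous_at_eps_delta dist_real_def by blast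
  obtain d2 where d2: "d2 > 0" "\<And>x. dist x z < d2 \<Longrightarrow> \<bar>?D v u x - ?D v u z\<bar> < e"
    using cont[of v u] e unfolding continuous_at_eps_delta dist_real_def by blast
  obtain d3 where d3: "d3 > 0" "ball z d3 \<subseteq> S"
    using assms openE by blast
  define d where "d = Min {d1, d2, d3}"
  have d: "d > 0" "d \<le> d1" "d \<le> d2" "d \<le> d3" using d1 d2 d3 by (auto simp: d_def)
  \<comment> \<open>This scale keeps the whole parallelogram within distance \<open>d\<close> of
    \<open>z\<close>; the summand 1 keeps the denominator positive when both directions
    vanish.\<close>
  define h where "h = d / (norm u + norm v + 1)"
  have h: "h > 0" unfolding h_def using d by (intro divide_pos_pos add_nonneg_pos) auto
  have hd: "h * (norm u + norm v) < d"
  proof -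
    have "h * (norm u + norm v) < h * (norm u + norm v + 1)" using h by simp
    also have "\<dots> = d" unfolding h_def using norm_ge_zero[of u] norm_ge_zero[of v]
      by (simp add: add_nonneg_eq_0_iff)
    finally show ?thesis .
  qed
  \<comment> \<open>The condition on the set of directions covers both orders in which
    \<open>u\<close> and \<open>v\<close> are used.\<close>
  have near: "dist (z + s *\<^sub>R u' + t *\<^sub>R v') z < d"
    if "0 \<le> s" "s \<le> h" "0 \<le> t" "t \<le> h" "{u', v'} = {u, v}" for s t u' v'
  proof -
    have "dist (z + s *\<^sub>R u' + t *\<^sub>R v') z = norm (s *\<^sub>R u' + t *\<^sub>R v')"
      by (simp add: dist_norm add.assoc)
    also have "\<dots> \<le> norm (s *\<^sub>R u') + norm (t *\<^sub>R v')" by (rule norm_triangle_ineq)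
    also have "\<dots> \<le> h * norm u' + h * norm v'"
      using that by (auto intro!: add_mono mult_right_mono)
    also have "\<dots> = h * (norm u + norm v)"
      using that(5) by (auto simp: doubleton_eq_iff algebra_simps)
    finally show ?thesis using hd by simp
  qed
  have inS: "z + s *\<^sub>R u' + t *\<^sub>R v' \<in> S"
    if "0 \<le> s" "s \<le> h" "0 \<le> t" "t \<le> h" "{u', v'} = {u, v}" for s t u' v'
    using near[OF that] d d3 by (force simp: dist_commute)
  obtain s t where st: "0 \<le> s" "s \<le> h" "0 \<le> t" "t \<le> h"
    "f (z + h *\<^sub>R u + h *\<^sub>R v) - f (z + h *\<^sub>R u) - f (z + h *\<^sub>R v) + f z
      = h * h * ?D u v (z + s *\<^sub>R u + t *\<^sub>R v)"
    using second_difference_mean_value[OF assms(2) h, of z u v] inS by auto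
  obtain s' t' where st': "0 \<le> s'" "s' \<le> h" "0 \<le> t'" "t' \<le> h"
    "f (z + h *\<^sub>R v + h *\<^sub>R u) - f (z + h *\<^sub>R v) - f (z + h *\<^sub>R u) + f z
      = h * h * ?D v u (z + s' *\<^sub>R v + t' *\<^sub>R u)"
    using second_difference_mean_value[OF assms(2) h, of z v u] inS[of _ _ v u] by auto
  have "h * h * ?D u v (z + s *\<^sub>R u + t *\<^sub>R v) = h * h * ?D v u (z + s' *\<^sub>R v + t' *\<^sub>R u)"
    using st(5) st'(5) by (simp add: algebra_simps)
  then have eq: "?D u v (z + s *\<^sub>R u + t *\<^sub>R v) = ?D v u (z + s' *\<^sub>R v + t' *\<^sub>R u)"
    using h by simp
  have "\<bar>?D u v (z + s *\<^sub>R u + t *\<^sub>R v) - ?D u v z\<bar> < e"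
    using d1(2) near[OF st(1-4), of u v] d by force
  moreover have "\<bar>?D v u (z + s' *\<^sub>R v + t' *\<^sub>R u) - ?D v u z\<bar> < e"
    using d2(2) near[OF st'(1-4), of v u] d by force
  ultimately have "\<bar>?D u v z - ?D v u z\<bar> < e + e"
    using abs_triangle_ineq4[of "?D v u (z + s' *\<^sub>R v + t' *\<^sub>R u) - ?D v u z"
        "?D u v (z + s *\<^sub>R u + t *\<^sub>R v) - ?D u v z"] unfolding eq by simp
  then show False by (simp add: e_def)
qed

section \<open>Homogeneous functions\<close>

text \<open>Moves a contraction with \<open>y\<close> past an inner sum, onto the only factor that
  carries the contracted index.\<close>

lemma sum_mult_swap:
  fixes a :: "'i \<Rightarrow> 'a::comm_semiring_0"
  shows "(\<Sum>j\<in>J. y j * (\<Sum>m\<in>I. a m * b m j)) = (\<Sum>m\<in>I. a m * (\<Sum>j\<in>J. y j * b m j))"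
proof -
  have "(\<Sum>j\<in>J. y j * (\<Sum>m\<in>I. a m * b m j)) = (\<Sum>j\<in>J. \<Sum>m\<in>I. a m * (y j * b m j))"
    by (simp add: sum_distrib_left mult.left_commute)
  also have "\<dots> = (\<Sum>m\<in>I. \<Sum>j\<in>J. a m * (y j * b m j))"
    by (rule sum.swap)
  finally show ?thesis by (simp add: sum_distrib_left)
qed

text \<open>The shape fits products of connection coefficients after a projective change: each
  factor has three terms, and \<open>a\<close>, \<open>b\<close>, \<open>c\<close>, \<open>d\<close>
  are the quantities free of the summation index.\<close>

lemma sum_product_expand:
  fixes u u' u'' v v' v'' :: "'i \<Rightarrow> real"
  shows "(\<Sum>s\<in>I. (u s + a * u' s + b * u'' s) * (v s + v' s * c + d * v'' s))
    = (\<Sum>s\<in>I. u s * v s) + c * (\<Sum>s\<in>I. u s * v' s) + d * (\<Sum>s\<in>I. u s * v'' s)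
      + a * (\<Sum>s\<in>I. u' s * v s) + a * c * (\<Sum>s\<in>I. u' s * v' s) + a * d * (\<Sum>s\<in>I. u' s * v'' s)
      + b * (\<Sum>s\<in>I. u'' s * v s) + b * c * (\<Sum>s\<in>I. u'' s * v' s) + b * d * (\<Sum>s\<in>I. u'' s * v'' s)"
  by (simp add: distrib_left distrib_right sum.distrib sum_distrib_left mult_ac)

lemma snd_component_has_derivative:
  fixes j :: "'n::finite"
  shows "((\<lambda>w. snd w $ j) has_derivative (\<lambda>v. snd v $ j)) (at (z :: (real^'n) \<times> (real^'n)))"
  by (intro bounded_linear_imp_has_derivative bounded_linear_compose[OF bounded_linear_vec_nth]
      bounded_linear_snd)

lemma derivative_components:
  fixes f :: "(real^'n::finite) \<times> (real^'n) \<Rightarrow> real"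
  assumes "f differentiable (at z)"
  shows "frechet_derivative f (at z) (u, v)
    = (\<Sum>i\<in>UNIV. u $ i * dx i f z) + (\<Sum>i\<in>UNIV. v $ i * dy i f z)"
proof -
  let ?L = "frechet_derivative f (at z)"
  have L: "linear ?L"
    by (rule linear_frechet_derivative[OF assms])
  have L1: "linear (\<lambda>u. ?L (u, 0))" and L2: "linear (\<lambda>v. ?L (0, v))"
    by (rule linearI; simp add: linear_add[OF L, symmetric] linear_scale[OF L, symmetric]
        flip: real_scaleR_def)+
  have expand: "w = (\<Sum>i\<in>UNIV. w $ i *\<^sub>R axis i 1)" for w :: "real^'n"
    using basis_expansion[of w] by (simp add: scalar_mult_eq_scaleR)
  have "?L (u, v) = ?L (u, 0) + ?L (0, v)"
    using linear_add[OF L, of "(u, 0)" "(0, v)"] by simp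
  also have "?L (u, 0) = (\<Sum>i\<in>UNIV. u $ i * dx i f z)"
    by (subst expand[of u]) (simp add: linear_sum[OF L1] linear_scale[OF L1] dx_def)
  also have "?L (0, v) = (\<Sum>i\<in>UNIV. v $ i * dy i f z)"
    by (subst expand[of v]) (simp add: linear_sum[OF L2] linear_scale[OF L2] dy_def)
  finally show ?thesis .
qed

section \<open>Calculus in the coordinates (x, y) off the zero section\<close>

text \<open>An arbitrary open set is allowed so that the same calculus serves a whole
  \<open>slit_region\<close> and the part of it over the overlap of two charts.\<close>

locale slit_domain =
  fixes S :: "((real^'n::finite) \<times> (real^'n)) set"
  assumes open_S: "open S" and snd_nonzero: "z \<in> S \<Longrightarrow> snd z \<noteq> 0"
begin

lemma smooth_on_dx [simp, intro]: "smooth_on S f \<Longrightarrow> smooth_on S (dx i f)"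
  using smooth_on_derivative[of S f] by (simp add: dx_def[abs_def])

lemma smooth_on_dy [simp, intro]: "smooth_on S f \<Longrightarrow> smooth_on S (dy i f)"
  using smooth_on_derivative[of S f] by (simp add: dy_def[abs_def])

lemma smooth_on_snd_component [simp, intro]: "smooth_on S (\<lambda>w. snd w $ j)"
  by (intro smooth_on_linear open_S bounded_linear_compose[OF bounded_linear_vec_nth]
      bounded_linear_snd)

lemmas smooth_on_arith [simp, intro] =
  smooth_on_const smooth_on_add[OF open_S] smooth_on_mult[OF open_S] smooth_on_diff[OF open_S]
  smooth_on_sum[OF open_S]

lemma dx_cong: "z \<in> S \<Longrightarrow> (\<And>w. w \<in> S \<Longrightarrow> f w = g w) \<Longrightarrow> dx i f z = dx i g z"
  unfolding dx_def using frechet_derivative_cong_open[OF open_S, of z f g] by simp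

lemma dy_cong: "z \<in> S \<Longrightarrow> (\<And>w. w \<in> S \<Longrightarrow> f w = g w) \<Longrightarrow> dy i f z = dy i g z"
  unfolding dy_def using frechet_derivative_cong_open[OF open_S, of z f g] by simp

lemma dx_const [simp]: "dx i (\<lambda>_. c) z = 0"
  by (simp add: dx_def)

lemma dy_const [simp]: "dy i (\<lambda>_. c) z = 0"
  by (simp add: dy_def)

lemma dx_snd [simp]:
  fixes j :: 'n
  shows "dx i (\<lambda>w. snd w $ j) z = 0"
  by (simp add: dx_def
      fun_cong[OF frechet_derivative_at[OF snd_component_has_derivative], symmetric])

lemma dy_snd [simp]:
  fixes j :: 'n
  shows "dy i (\<lambda>w. snd w $ j) z = (if i = j then 1 else 0)"
  by (simp add: dy_def axis_def
      fun_cong[OF frechet_derivative_at[OF snd_component_has_derivative], symmetric])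

lemma dx_add [simp]: "z \<in> S \<Longrightarrow> smooth_on S f \<Longrightarrow> smooth_on S g \<Longrightarrow>
    dx i (\<lambda>w. f w + g w) z = dx i f z + dx i g z"
  by (simp add: dx_def frechet_derivative_add smooth_on_differentiable[where S=S])

lemma dy_add [simp]: "z \<in> S \<Longrightarrow> smooth_on S f \<Longrightarrow> smooth_on S g \<Longrightarrow>
    dy i (\<lambda>w. f w + g w) z = dy i f z + dy i g z"
  by (simp add: dy_def frechet_derivative_add smooth_on_differentiable[where S=S])

lemma dx_mult [simp]: "z \<in> S \<Longrightarrow> smooth_on S f \<Longrightarrow> smooth_on S g \<Longrightarrow>
    dx i (\<lambda>w. f w * g w) z = f z * dx i g z + dx i f z * g z"
  by (simp add: dx_def frechet_derivative_mult smooth_on_differentiable[where S=S])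

lemma dy_mult [simp]: "z \<in> S \<Longrightarrow> smooth_on S f \<Longrightarrow> smooth_on S g \<Longrightarrow>
    dy i (\<lambda>w. f w * g w) z = f z * dy i g z + dy i f z * g z"
  by (simp add: dy_def frechet_derivative_mult smooth_on_differentiable[where S=S])

lemma dx_sum [simp]: "z \<in> S \<Longrightarrow> (\<And>j. j \<in> J \<Longrightarrow> smooth_on S (f j)) \<Longrightarrow>
    dx i (\<lambda>w. \<Sum>j\<in>J. f j w) z = (\<Sum>j\<in>J. dx i (f j) z)"
  by (induction J rule: infinite_finite_induct) simp_all

lemma dy_sum [simp]: "z \<in> S \<Longrightarrow> (\<And>j. j \<in> J \<Longrightarrow> smooth_on S (f j)) \<Longrightarrow>
    dy i (\<lambda>w. \<Sum>j\<in>J. f j w) z = (\<Sum>j\<in>J. dy i (f j) z)"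
  by (induction J rule: infinite_finite_induct) simp_all

lemma dx_dx_commute: "z \<in> S \<Longrightarrow> smooth_on S f \<Longrightarrow> dx i (dx j f) z = dx j (dx i f) z"
  unfolding dx_def[abs_def] by (rule clairaut[OF open_S])

lemma dx_dy_commute: "z \<in> S \<Longrightarrow> smooth_on S f \<Longrightarrow> dx i (dy j f) z = dy j (dx i f) z"
  unfolding dx_def[abs_def] dy_def[abs_def] by (rule clairaut[OF open_S])

lemma dy_dy_commute: "z \<in> S \<Longrightarrow> smooth_on S f \<Longrightarrow> dy i (dy j f) z = dy j (dy i f) z"
  unfolding dy_def[abs_def] by (rule clairaut[OF open_S])

text \<open>Homogeneity in \<open>y\<close> is encoded by Euler's identity, because \<open>S\<close> need not be conic and the
  degree may be negative.\<close>

definition hom :: "real \<Rightarrow> ((real^'n) \<times> (real^'n) \<Rightarrow> real) \<Rightarrow> bool" where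
  "hom r f \<longleftrightarrow> smooth_on S f \<and> (\<forall>z\<in>S. (\<Sum>m\<in>UNIV. snd z $ m * dy m f z) = r * f z)"

lemma hom_smooth: "hom r f \<Longrightarrow> smooth_on S f"
  by (simp add: hom_def)

lemma euler: "hom r f \<Longrightarrow> z \<in> S \<Longrightarrow> (\<Sum>m\<in>UNIV. snd z $ m * dy m f z) = r * f z"
  by (simp add: hom_def)

lemma hom_cong: "hom r f \<Longrightarrow> (\<And>z. z \<in> S \<Longrightarrow> f z = g z) \<Longrightarrow> hom r g"
  unfolding hom_def using smooth_on_cong[OF open_S, of f g] dy_cong[of _ f g] by auto

lemma hom_snd: "hom 1 (\<lambda>w. snd w $ j)"
  by (simp add: hom_def if_distrib cong: if_cong)

lemma hom_zero: "hom r (\<lambda>_. 0)"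
  by (simp add: hom_def)

lemma hom_add:
  assumes "hom r f" "hom r g"
  shows "hom r (\<lambda>w. f w + g w)"
  using assms by (simp add: hom_def distrib_left sum.distrib)

lemma hom_mult:
  assumes "hom r f" "hom s g" "t = r + s"
  shows "hom t (\<lambda>w. f w * g w)"
proof -
  have "(\<Sum>m\<in>UNIV. snd z $ m * dy m (\<lambda>w. f w * g w) z) = t * (f z * g z)" if z: "z \<in> S" for z
  proof -
    have "(\<Sum>m\<in>UNIV. snd z $ m * dy m (\<lambda>w. f w * g w) z)
        = f z * (\<Sum>m\<in>UNIV. snd z $ m * dy m g z) + (\<Sum>m\<in>UNIV. snd z $ m * dy m f z) * g z"
      using assms z
      by (simp add: hom_smooth[of _ f] hom_smooth[of _ g] distrib_left sum.distrib
          sum_distrib_left sum_distrib_right mult_ac)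
    then show ?thesis using assms z
      by (simp only: euler[OF assms(1)] euler[OF assms(2)]) (simp add: algebra_simps)
  qed
  then show ?thesis using assms by (simp add: hom_def)
qed

lemma hom_cmult: "hom r f \<Longrightarrow> hom r (\<lambda>w. c * f w)"
  using hom_mult[of 0 "\<lambda>_. c" r f r] by (simp add: hom_def)

lemma hom_diff: "hom r f \<Longrightarrow> hom r g \<Longrightarrow> hom r (\<lambda>w. f w - g w)"
  using hom_add[OF _ hom_cmult, of r f g "-1"] by simp

lemma hom_sum: "(\<And>j. j \<in> J \<Longrightarrow> hom r (f j)) \<Longrightarrow> hom r (\<lambda>w. \<Sum>j\<in>J. f j w)"
  by (induction J rule: infinite_finite_induct) (simp_all add: hom_zero hom_add)

text \<open>This is Euler's identity differentiated in x, which leaves the factors y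
  untouched.\<close>

lemma contract_dx_dy:
  assumes "hom r f" "z \<in> S"
  shows "(\<Sum>m\<in>UNIV. snd z $ m * dx k (dy m f) z) = r * dx k f z"
proof -
  have "dx k (\<lambda>w. \<Sum>m\<in>UNIV. snd w $ m * dy m f w) z = dx k (\<lambda>w. r * f w) z"
    using assms by (intro dx_cong) (auto simp: euler)
  then show ?thesis using assms by (simp add: hom_smooth)
qed

text \<open>Differentiating Euler's identity in y also hits the factor y and produces one extra
  \<open>dy k f\<close>; hence the coefficient \<open>r - 1\<close>.\<close>

lemma contract_dy_dy:
  assumes "hom r f" "z \<in> S"
  shows "(\<Sum>m\<in>UNIV. snd z $ m * dy k (dy m f) z) = (r - 1) * dy k f z"
proof -
  have "dy k (\<lambda>w. \<Sum>m\<in>UNIV. snd w $ m * dy m f w) z = dy k (\<lambda>w. r * f w) z"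
    using assms by (intro dy_cong) (auto simp: euler)
  then show ?thesis using assms
    by (simp add: hom_smooth sum.distrib if_distrib[of "\<lambda>a. _ * a"] algebra_simps cong: if_cong)
qed

lemma hom_dx: "hom r f \<Longrightarrow> hom r (dx k f)"
  using contract_dx_dy[of r f _ k] by (simp add: hom_def dx_dy_commute)

lemma hom_dy: "hom r f \<Longrightarrow> s = r - 1 \<Longrightarrow> hom s (dy k f)"
  using contract_dy_dy[of r f _ k] by (simp add: hom_def dy_dy_commute)

text \<open>The derivative at \<open>t = 0\<close> of \<open>f\<close> at (x, (1 + t) y) is computed
  twice: by the chain rule and from the power law.\<close>

lemma hom_of_homogeneous:
  fixes f :: "(real^'n) \<times> (real^'n) \<Rightarrow> real"
  assumes f: "smooth_on S f" and h: "\<And>x y t. (x, y) \<in> S \<Longrightarrow> t > 0 \<Longrightarrow> f (x, t *\<^sub>R y) = t ^ k * f (x, y)"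
  shows "hom (real k) f"
  unfolding hom_def
proof (intro conjI f ballI)
  fix z assume z: "z \<in> S"
  obtain x y where xy: "z = (x, y)" by fastforce
  have line: "z + t *\<^sub>R (0, y) = (x, (1 + t) *\<^sub>R y)" for t
    by (simp add: xy scaleR_add_left)
  have "((\<lambda>t. f (z + t *\<^sub>R (0, y))) has_real_derivative frechet_derivative f (at z) (0, y)) (at 0)"
    using has_derivative_along_line[of f z 0 "(0, y)"] smooth_on_differentiable[OF f z]
    by (simp add: zero_prod_def[symmetric])
  moreover have "((\<lambda>t. f (z + t *\<^sub>R (0, y))) has_real_derivative real k * f z) (at 0)"
  \<comment> \<open>On this interval \<open>1 + t\<close> stays positive, as the scaling law
    requires.\<close>
  proof (rule has_field_derivative_transform_within_open[of "\<lambda>t. (1 + t) ^ k * f z" _ _ "{-1<..}"])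
    show "((\<lambda>t. (1 + t) ^ k * f z) has_real_derivative real k * f z) (at 0)"
      by (auto intro!: derivative_eq_intros)
    show "(1 + t) ^ k * f z = f (z + t *\<^sub>R (0, y))" if "t \<in> {-1<..}" for t
      using h[of x y "1 + t"] z that unfolding line by (simp add: xy)
  qed auto
  ultimately have "frechet_derivative f (at z) (0, y) = real k * f z"
    by (rule DERIV_unique)
  moreover have "frechet_derivative f (at z) (0, y) = (\<Sum>m\<in>UNIV. snd z $ m * dy m f z)"
    using derivative_components[OF smooth_on_differentiable[OF f z]] by (simp add: xy)
  ultimately show "(\<Sum>m\<in>UNIV. snd z $ m * dy m f z) = real k * f z" by simp
qed

section \<open>Curvature and projective changes\<close>

lemmas contract_sum = sum_mult_swap[of "\<lambda>j. snd z $ j" for z :: "(real^'n) \<times> (real^'n)"]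

definition spray_on :: "((real^'n) \<times> (real^'n) \<Rightarrow> real^'n) \<Rightarrow> bool" where
  "spray_on G \<longleftrightarrow> (\<forall>i. hom 2 (\<lambda>z. G z $ i))"

lemma hom_N: "spray_on G \<Longrightarrow> hom 1 (N_conn G i k)"
  unfolding spray_on_def N_conn_def by (auto intro: hom_dy)

lemma Gamma_conn_alt: "Gamma_conn G i j k = dy j (N_conn G i k)"
  by (simp add: Gamma_conn_def N_conn_def)

lemma hom_Gamma: "spray_on G \<Longrightarrow> hom 0 (Gamma_conn G i j k)"
  unfolding Gamma_conn_alt by (rule hom_dy[OF hom_N]) auto

lemma Gamma_symmetric:
  assumes "spray_on G" "z \<in> S"
  shows "Gamma_conn G i j k z = Gamma_conn G i k j z"
  unfolding Gamma_conn_def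
  using assms by (intro dy_dy_commute) (auto simp: spray_on_def intro: hom_smooth)

lemma contract_N:
  assumes "spray_on G" "z \<in> S"
  shows "(\<Sum>j\<in>UNIV. snd z $ j * N_conn G i j z) = 2 * G z $ i"
  using euler[of 2 "\<lambda>z. G z $ i" z] assms by (simp add: spray_on_def N_conn_def)

lemma contract_Gamma:
  assumes "spray_on G" "z \<in> S"
  shows "(\<Sum>j\<in>UNIV. snd z $ j * Gamma_conn G i j k z) = N_conn G i k z"
  using euler[OF hom_N[OF assms(1)] assms(2)] by (simp add: Gamma_conn_alt)

lemma contract_Gamma':
  assumes "spray_on G" "z \<in> S"
  shows "(\<Sum>j\<in>UNIV. snd z $ j * Gamma_conn G i k j z) = N_conn G i k z"
  using contract_Gamma[OF assms] by (simp add: Gamma_symmetric[OF assms, of i k])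

text \<open>The vertical part drops out: \<open>N_conn\<close> has degree one, so its second
  y-derivatives contract to zero by \<open>contract_dy_dy\<close>.\<close>

lemma contract_horiz_deriv_Gamma:
  assumes "spray_on G" "z \<in> S"
  shows "(\<Sum>j\<in>UNIV. snd z $ j * horiz_deriv G l (Gamma_conn G i j k) z) = dx l (N_conn G i k) z"
proof -
  have "(\<Sum>j\<in>UNIV. snd z $ j * horiz_deriv G l (Gamma_conn G i j k) z)
      = (\<Sum>j\<in>UNIV. snd z $ j * dx l (Gamma_conn G i j k) z)
        - (\<Sum>m\<in>UNIV. N_conn G m l z * (\<Sum>j\<in>UNIV. snd z $ j * dy m (Gamma_conn G i j k) z))"
    unfolding horiz_deriv_def by (simp only: right_diff_distrib sum_subtractf contract_sum)
  also have "\<dots> = dx l (N_conn G i k) z"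
    unfolding Gamma_conn_alt
    by (simp add: contract_dx_dy[OF hom_N[OF assms(1)] assms(2)]
        contract_dy_dy[OF hom_N[OF assms(1)] assms(2)])
  finally show ?thesis .
qed

lemma contract_Riem:
  assumes "spray_on G" "z \<in> S"
  shows "(\<Sum>j\<in>UNIV. snd z $ j * Riem G i j k l z)
    = dx k (N_conn G i l) z - dx l (N_conn G i k) z
      + (\<Sum>s\<in>UNIV. Gamma_conn G i k s z * N_conn G s l z)
      - (\<Sum>s\<in>UNIV. N_conn G s k z * Gamma_conn G i l s z)"
proof -
  have "(\<Sum>j\<in>UNIV. snd z $ j * (\<Sum>s\<in>UNIV. Gamma_conn G s j k z * Gamma_conn G i l s z))
      = (\<Sum>s\<in>UNIV. N_conn G s k z * Gamma_conn G i l s z)"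
    using sum_mult_swap[of "\<lambda>j. snd z $ j" "\<lambda>s. Gamma_conn G i l s z" "\<lambda>s j. Gamma_conn G s j k z" UNIV UNIV]
    by (simp add: contract_Gamma[OF assms] mult.commute)
  then show ?thesis
    unfolding Riem_def
    by (simp add: right_diff_distrib distrib_left sum_subtractf sum.distrib contract_sum
        contract_horiz_deriv_Gamma[OF assms] contract_Gamma[OF assms])
qed

text \<open>Contracting with y in both outer slots turns every derivative of
  \<open>Gamma_conn\<close> into one of \<open>N_conn\<close> or of \<open>G\<close>. This is
  Berwald's formula; being free of third derivatives of \<open>G\<close>, it is the form in which a
  projective change is computed.\<close>

lemma berwald_formula:
  assumes "spray_on G" "z \<in> S"
  shows "Riem2 G i k z = 2 * dx k (\<lambda>z. G z $ i) z - (\<Sum>l\<in>UNIV. snd z $ l * dx l (N_conn G i k) z)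
    + 2 * (\<Sum>s\<in>UNIV. G z $ s * Gamma_conn G i k s z)
    - (\<Sum>s\<in>UNIV. N_conn G s k z * N_conn G i s z)"
proof -
  have G: "hom 2 (\<lambda>z. G z $ i)" using assms by (simp add: spray_on_def)
  have "Riem2 G i k z = (\<Sum>l\<in>UNIV. \<Sum>j\<in>UNIV. snd z $ j * Riem G i j k l z * snd z $ l)"
    unfolding Riem2_def by (rule sum.swap)
  also have "\<dots> = (\<Sum>l\<in>UNIV. snd z $ l * (\<Sum>j\<in>UNIV. snd z $ j * Riem G i j k l z))"
    by (simp add: sum_distrib_left mult_ac)
  also have "\<dots> = (\<Sum>l\<in>UNIV. snd z $ l * dx k (N_conn G i l) z)
      - (\<Sum>l\<in>UNIV. snd z $ l * dx l (N_conn G i k) z)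
      + (\<Sum>s\<in>UNIV. Gamma_conn G i k s z * (\<Sum>l\<in>UNIV. snd z $ l * N_conn G s l z))
      - (\<Sum>s\<in>UNIV. N_conn G s k z * (\<Sum>l\<in>UNIV. snd z $ l * Gamma_conn G i l s z))"
    unfolding contract_Riem[OF assms]
    by (simp only: right_diff_distrib distrib_left sum_subtractf sum.distrib contract_sum)
  also have "(\<Sum>l\<in>UNIV. snd z $ l * dx k (N_conn G i l) z) = 2 * dx k (\<lambda>z. G z $ i) z"
    unfolding N_conn_def by (rule contract_dx_dy[OF G assms(2)])
  finally show ?thesis
    by (simp add: contract_N[OF assms] contract_Gamma[OF assms] sum_distrib_left mult_ac)
qed

text \<open>A degree count in each term of Berwald's formula.\<close>

lemma hom_Riem2:
  assumes "spray_on G"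
  shows "hom 2 (Riem2 G i k)"
proof (rule hom_cong)
  have G: "hom 2 (\<lambda>z. G z $ i)" for i using assms by (simp add: spray_on_def)
  show "hom 2 (\<lambda>z. 2 * dx k (\<lambda>z. G z $ i) z - (\<Sum>l\<in>UNIV. snd z $ l * dx l (N_conn G i k) z)
    + 2 * (\<Sum>s\<in>UNIV. G z $ s * Gamma_conn G i k s z)
    - (\<Sum>s\<in>UNIV. N_conn G s k z * N_conn G i s z))"
    by (intro hom_add hom_diff hom_cmult hom_sum hom_dx G hom_mult[OF hom_snd hom_dx[OF hom_N]]
        hom_mult[OF G hom_Gamma] hom_mult[OF hom_N hom_N] assms) auto
qed (simp add: berwald_formula[OF assms])

text \<open>After contraction of Berwald's formula the two terms with x-derivatives cancel, and so
  do the two quadratic ones.\<close>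

lemma contract_Riem2:
  assumes "spray_on G" "z \<in> S"
  shows "(\<Sum>k\<in>UNIV. snd z $ k * Riem2 G i k z) = 0"
proof -
  have G: "hom 2 (\<lambda>z. G z $ i)" using assms by (simp add: spray_on_def)
  have "(\<Sum>k\<in>UNIV. snd z $ k * (\<Sum>s\<in>UNIV. N_conn G s k z * N_conn G i s z))
      = (\<Sum>s\<in>UNIV. N_conn G i s z * (2 * G z $ s))"
    using sum_mult_swap[of "\<lambda>k. snd z $ k" "\<lambda>s. N_conn G i s z" "\<lambda>s k. N_conn G s k z" UNIV UNIV]
    by (simp add: contract_N[OF assms] mult.commute)
  moreover have "(\<Sum>k\<in>UNIV. snd z $ k * (\<Sum>s\<in>UNIV. G z $ s * Gamma_conn G i k s z))
      = (\<Sum>s\<in>UNIV. G z $ s * N_conn G i s z)"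
    by (simp only: contract_sum contract_Gamma[OF assms])
  moreover have "(\<Sum>k\<in>UNIV. snd z $ k * (\<Sum>l\<in>UNIV. snd z $ l * dx l (N_conn G i k) z))
      = (\<Sum>l\<in>UNIV. snd z $ l * (2 * dx l (\<lambda>z. G z $ i) z))"
    by (subst sum_mult_swap) (simp add: N_conn_def contract_dx_dy[OF G assms(2)])
  moreover have "(\<Sum>k\<in>UNIV. snd z $ k * Riem2 G i k z)
    = 2 * (\<Sum>k\<in>UNIV. snd z $ k * dx k (\<lambda>z. G z $ i) z)
      - (\<Sum>k\<in>UNIV. snd z $ k * (\<Sum>l\<in>UNIV. snd z $ l * dx l (N_conn G i k) z))
      + 2 * (\<Sum>k\<in>UNIV. snd z $ k * (\<Sum>s\<in>UNIV. G z $ s * Gamma_conn G i k s z))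
      - (\<Sum>k\<in>UNIV. snd z $ k * (\<Sum>s\<in>UNIV. N_conn G s k z * N_conn G i s z))"
    unfolding berwald_formula[OF assms]
    by (simp only: right_diff_distrib distrib_left sum_subtractf sum.distrib sum_distrib_left
        mult.left_commute)
  ultimately show ?thesis
    by (simp add: sum_distrib_left mult_ac)
qed

section \<open>The curvature under a projective change\<close>

text \<open>The new coefficients are put into Berwald's formula. The cross terms \<open>P\<close>
  times \<open>N_conn\<close> and \<open>dy k P\<close> times \<open>G\<close> cancel; everything
  else new is a multiple of the identity or of y.\<close>

lemma projective_change_Riem2:
  assumes G: "spray_on G" and P: "hom 1 P" and eq: "\<And>w. w \<in> S \<Longrightarrow> G' w = G w + P w *\<^sub>R snd w"
  shows "spray_on G' \<and> (\<exists>E \<tau>. hom 2 E \<and> (\<forall>k. hom 1 (\<tau> k)) \<and>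
    (\<forall>z\<in>S. \<forall>i k. Riem2 G' i k z
      = Riem2 G i k z + (E z * (if i = k then 1 else 0) + \<tau> k z * snd z $ i)))"
proof (intro conjI)
  have Gi: "hom 2 (\<lambda>w. G w $ i)" for i using G by (simp add: spray_on_def)
  have eqi: "w \<in> S \<Longrightarrow> G' w $ i = G w $ i + P w * snd w $ i" for w i
    by (simp add: eq)
  show G': "spray_on G'"
    unfolding spray_on_def
  proof
    fix i
    show "hom 2 (\<lambda>w. G' w $ i)"
      by (rule hom_cong[OF hom_add[OF Gi hom_mult[OF P hom_snd]]]) (auto simp: eqi)
  qed
  note sm [simp] = hom_smooth[OF P] hom_smooth[OF Gi] hom_smooth[OF hom_N[OF G]]
    hom_smooth[OF hom_Gamma[OF G]]
  let ?\<delta> = "\<lambda>k i :: 'n. if k = i then 1 else 0 :: real"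
  have N': "N_conn G' i k w = N_conn G i k w + dy k P w * snd w $ i + P w * ?\<delta> k i"
    if "w \<in> S" for i k w
  proof -
    have "dy k (\<lambda>w. G' w $ i) w = dy k (\<lambda>w. G w $ i + P w * snd w $ i) w"
      using that by (rule dy_cong) (rule eqi)
    then show ?thesis using that by (simp add: N_conn_def)
  qed
  have Gamma': "Gamma_conn G' i j k w = Gamma_conn G i j k w + dy j (dy k P) w * snd w $ i
      + dy k P w * ?\<delta> j i + dy j P w * ?\<delta> k i"
    if "w \<in> S" for i j k w
  proof -
    have "dy j (N_conn G' i k) w
        = dy j (\<lambda>w. N_conn G i k w + dy k P w * snd w $ i + P w * ?\<delta> k i) w"
      using that by (rule dy_cong) (rule N')
    then show ?thesis using that by (simp add: Gamma_conn_alt)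
  qed
  have dxN': "dx l (N_conn G' i k) w
      = dx l (N_conn G i k) w + dx l (dy k P) w * snd w $ i + dx l P w * ?\<delta> k i"
    if "w \<in> S" for i l k w
  proof -
    have "dx l (N_conn G' i k) w
        = dx l (\<lambda>w. N_conn G i k w + dy k P w * snd w $ i + P w * ?\<delta> k i) w"
      using that by (rule dx_cong) (rule N')
    then show ?thesis using that by simp
  qed
  \<comment> \<open>\<open>E\<close> gathers the coefficients of the Kronecker delta and
    \<open>\<tau>\<close> those of y in the transformed formula.\<close>
  define E where "E z = P z * P z - (\<Sum>l\<in>UNIV. snd z $ l * dx l P z)
    + 2 * (\<Sum>s\<in>UNIV. G z $ s * dy s P z)" for z
  define \<tau> where "\<tau> k z = 2 * dx k P z - (\<Sum>l\<in>UNIV. snd z $ l * dx l (dy k P) z)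
    + 2 * (\<Sum>s\<in>UNIV. G z $ s * dy k (dy s P) z) - (\<Sum>s\<in>UNIV. N_conn G s k z * dy s P z)
    - P z * dy k P z" for k z
  have dyP: "hom 0 (dy k P)" for k by (rule hom_dy[OF P]) simp
  have dydyP: "hom (- 1) (dy s (dy k P))" for s k by (rule hom_dy[OF dyP]) simp
  have "hom 2 E"
    unfolding E_def[abs_def]
    by (intro hom_add hom_diff hom_cmult hom_sum hom_mult[OF P P] hom_mult[OF hom_snd hom_dx[OF P]]
        hom_mult[OF Gi dyP]) auto
  moreover have "hom 1 (\<tau> k)" for k
    unfolding \<tau>_def[abs_def]
    by (intro hom_add hom_diff hom_cmult hom_sum hom_dx[OF P] hom_mult[OF hom_snd hom_dx[OF dyP]]
        hom_mult[OF Gi dydyP] hom_mult[OF hom_N[OF G] dyP] hom_mult[OF P dyP]) auto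
  moreover have "Riem2 G' i k z
      = Riem2 G i k z + (E z * (if i = k then 1 else 0) + \<tau> k z * snd z $ i)"
    if z: "z \<in> S" for i k z
  proof -
    have d [simp]: "(\<Sum>s\<in>UNIV. f s * ?\<delta> s j) = f j" "(\<Sum>s\<in>UNIV. ?\<delta> k s * f s) = f k" for f j k
      by (simp_all add: if_distrib[of "\<lambda>a. _ * a"] if_distrib[of "\<lambda>a. a * _"] cong: if_cong)
    have "dx k (\<lambda>w. G' w $ i) z = dx k (\<lambda>w. G w $ i + P w * snd w $ i) z"
      using z by (rule dx_cong) (rule eqi)
    then have 1: "dx k (\<lambda>w. G' w $ i) z = dx k (\<lambda>w. G w $ i) z + dx k P z * snd z $ i"
      using z by simp
    have 2: "(\<Sum>l\<in>UNIV. snd z $ l * dx l (N_conn G' i k) z)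
        = (\<Sum>l\<in>UNIV. snd z $ l * dx l (N_conn G i k) z)
          + (\<Sum>l\<in>UNIV. snd z $ l * dx l (dy k P) z) * snd z $ i
          + (\<Sum>l\<in>UNIV. snd z $ l * dx l P z) * ?\<delta> k i"
      using z by (simp only: dxN' distrib_left sum.distrib sum_distrib_right mult.assoc[symmetric])
    \<comment> \<open>The factors are brought into the three-term shape of
      \<open>sum_product_expand\<close>; \<open>0 * 0\<close> stands in for a missing third
      term.\<close>
    have "(\<Sum>s\<in>UNIV. G' z $ s * Gamma_conn G' i k s z)
        = (\<Sum>s\<in>UNIV. (G z $ s + P z * snd z $ s + 0 * 0) *
            ((Gamma_conn G i k s z + dy s P z * ?\<delta> k i)
              + dy k (dy s P) z * snd z $ i + dy k P z * ?\<delta> s i))"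
      using z by (simp add: Gamma' eqi algebra_simps)
    also have "\<dots> = (\<Sum>s\<in>UNIV. G z $ s * Gamma_conn G i k s z)
        + (\<Sum>s\<in>UNIV. G z $ s * dy s P z) * ?\<delta> k i
        + snd z $ i * (\<Sum>s\<in>UNIV. G z $ s * dy k (dy s P) z) + dy k P z * G z $ i
        + P z * N_conn G i k z + P z * P z * ?\<delta> k i + P z * dy k P z * snd z $ i"
      unfolding sum_product_expand
      \<comment> \<open>Since \<open>P\<close> has degree one, its second y-derivatives contract
        with y to zero.\<close>
      using contract_Gamma'[OF G z, of i k] contract_dy_dy[OF P z, of k] euler[OF P z]
      by (simp add: distrib_left sum.distrib sum_distrib_right mult.assoc[symmetric])
    finally have 3: "(\<Sum>s\<in>UNIV. G' z $ s * Gamma_conn G' i k s z) = \<dots>" .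
    have "(\<Sum>s\<in>UNIV. N_conn G' s k z * N_conn G' i s z)
        = (\<Sum>s\<in>UNIV. (N_conn G s k z + dy k P z * snd z $ s + P z * ?\<delta> k s)
            * (N_conn G i s z + dy s P z * snd z $ i + P z * ?\<delta> s i))"
      using z by (simp only: N')
    also have "\<dots> = (\<Sum>s\<in>UNIV. N_conn G s k z * N_conn G i s z)
        + snd z $ i * (\<Sum>s\<in>UNIV. N_conn G s k z * dy s P z) + P z * N_conn G i k z
        + 2 * dy k P z * G z $ i + 2 * dy k P z * P z * snd z $ i
        + P z * N_conn G i k z + P z * dy k P z * snd z $ i + P z * P z * ?\<delta> k i"
      unfolding sum_product_expand d
      using contract_N[OF G z, of i] euler[OF P z] by simp
    finally have 4: "(\<Sum>s\<in>UNIV. N_conn G' s k z * N_conn G' i s z) = \<dots>" .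
    show ?thesis
      unfolding berwald_formula[OF G z] berwald_formula[OF G' z] 1 2 3 4 E_def \<tau>_def
      by (simp add: algebra_simps)
  qed
  ultimately show "\<exists>E \<tau>. hom 2 E \<and> (\<forall>k. hom 1 (\<tau> k)) \<and>
    (\<forall>z\<in>S. \<forall>i k. Riem2 G' i k z
      = Riem2 G i k z + (E z * (if i = k then 1 else 0) + \<tau> k z * snd z $ i))"
    by blast
qed

section \<open>Isotropic curvature from vanishing chi-curvature\<close>

definition isotropic_on :: "((real^'n) \<times> (real^'n) \<Rightarrow> real^'n) \<Rightarrow> bool" where
  "isotropic_on G \<longleftrightarrow> (\<forall>z\<in>S. \<forall>i k. Riem2 G i k z
     = R_scalar G z * (if i = k then 1 else 0) - 1 / 2 * dy k (R_scalar G) z * snd z $ i)"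

text \<open>Two constraints tie the free coefficients together: the contraction of
  \<open>Riem2\<close> with y vanishes, which identifies \<open>Sc\<close> with
  \<open>R_scalar\<close>, and the vanishing of chi then determines \<open>\<sigma>\<close> as minus
  half the y-gradient of \<open>Sc\<close>.\<close>

lemma isotropic_of_scalar_curvature:
  assumes n: "CARD('n) \<ge> 2" and G: "spray_on G"
    and Sc: "hom 2 Sc" and \<sigma>: "\<And>k. hom 1 (\<sigma> k)"
    and R: "\<And>z i k. z \<in> S \<Longrightarrow>
      Riem2 G i k z = Sc z * (if i = k then 1 else 0) + \<sigma> k z * snd z $ i"
    and chi: "\<And>z k. z \<in> S \<Longrightarrow> chi_curv G k z = 0"
  shows "isotropic_on G"
proof -
  let ?n = "real CARD('n)"
  note sm [simp] = hom_smooth[OF Sc] hom_smooth[OF \<sigma>]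
  have S_eq: "(\<Sum>k\<in>UNIV. \<sigma> k z * snd z $ k) = - Sc z" if z: "z \<in> S" for z
  proof -
    \<comment> \<open>Away from the zero section some component of y is nonzero and can be
      cancelled.\<close>
    obtain i where i: "snd z $ i \<noteq> 0"
      using snd_nonzero[OF z] by (auto simp: vec_eq_iff)
    have "0 = (\<Sum>k\<in>UNIV. snd z $ k * (Sc z * (if i = k then 1 else 0) + \<sigma> k z * snd z $ i))"
      using contract_Riem2[OF G z, of i] z by (simp add: R)
    also have "\<dots> = snd z $ i * Sc z + snd z $ i * (\<Sum>k\<in>UNIV. \<sigma> k z * snd z $ k)"
      by (simp add: distrib_left sum.distrib sum_distrib_left if_distrib[of "\<lambda>a. _ * a"] mult_ac
          cong: if_cong)
    finally have "snd z $ i * (Sc z + (\<Sum>k\<in>UNIV. \<sigma> k z * snd z $ k)) = 0"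
      by (simp add: distrib_left)
    then show ?thesis using i by simp
  qed
  have trace: "(\<Sum>m\<in>UNIV. Riem2 G m m z) = (?n - 1) * Sc z" if z: "z \<in> S" for z
    using S_eq[OF z] z by (simp add: R sum.distrib algebra_simps)
  \<comment> \<open>Dimension at least two makes the factor \<open>n - 1\<close> of the trace
    cancellable.\<close>
  have Rs: "R_scalar G z = Sc z" if "z \<in> S" for z
    using trace[OF that] n by (simp add: R_scalar_def)
  have key: "dy k Sc z + 2 * \<sigma> k z = 0" if z: "z \<in> S" for k z
  proof -
    have "dy m (Riem2 G m k) z
        = dy m Sc z * (if m = k then 1 else 0) + snd z $ m * dy m (\<sigma> k) z + \<sigma> k z" for m
    proof -
      have "dy m (Riem2 G m k) z
          = dy m (\<lambda>w. Sc w * (if m = k then 1 else 0) + \<sigma> k w * snd w $ m) z"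
        using z by (rule dy_cong) (rule R)
      then show ?thesis using z by simp
    qed
    \<comment> \<open>The \<open>n\<close> undifferentiated copies of \<open>\<sigma> k\<close>,
      plus one more from Euler's identity in degree one, make the factor
      \<open>n + 1\<close>.\<close>
    then have "(\<Sum>m\<in>UNIV. dy m (Riem2 G m k) z) = dy k Sc z + (?n + 1) * \<sigma> k z"
      using euler[OF \<sigma>[of k] z]
      by (simp add: sum.distrib if_distrib[of "\<lambda>a. _ * a"] algebra_simps cong: if_cong)
    moreover have "dy k (\<lambda>w. \<Sum>m\<in>UNIV. Riem2 G m m w) z = dy k (\<lambda>w. (?n - 1) * Sc w) z"
      using z by (rule dy_cong) (rule trace)
    then have "dy k (\<lambda>w. \<Sum>m\<in>UNIV. Riem2 G m m w) z = (?n - 1) * dy k Sc z"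
      using z by simp
    ultimately have "(?n + 1) * (dy k Sc z + 2 * \<sigma> k z) = 0"
      using chi[OF z, of k] by (simp add: chi_curv_def algebra_simps)
    then show ?thesis by (simp add: add_nonneg_eq_0_iff)
  qed
  show ?thesis
    unfolding isotropic_on_def
  proof (intro ballI allI)
    fix z i k assume z: "z \<in> S"
    have "dy k (R_scalar G) z = dy k Sc z"
      using z by (rule dy_cong) (rule Rs)
    moreover have "\<sigma> k z = - 1 / 2 * dy k Sc z" using key[OF z, of k] by simp
    ultimately show "Riem2 G i k z
       = R_scalar G z * (if i = k then 1 else 0) - 1 / 2 * dy k (R_scalar G) z * snd z $ i"
      using z by (simp add: R Rs)
  qed
qed

text \<open>A projective change keeps the shape "multiple of the identity plus multiple of y" of the
  curvature; the vanishing chi-curvature of \<open>G'\<close> restores the isotropic relation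
  between the two coefficients.\<close>

lemma isotropic_on_projective_change:
  assumes n: "CARD('n) \<ge> 2" and G: "spray_on G" and iso: "isotropic_on G" and P: "hom 1 P"
    and eq: "\<And>w. w \<in> S \<Longrightarrow> G' w = G w + P w *\<^sub>R snd w"
    and chi: "\<And>z k. z \<in> S \<Longrightarrow> chi_curv G' k z = 0"
  shows "isotropic_on G'"
proof -
  obtain E \<tau> where G': "spray_on G'" and E: "hom 2 E" and \<tau>: "\<And>k. hom 1 (\<tau> k)"
    and R': "\<And>z i k. z \<in> S \<Longrightarrow> Riem2 G' i k z
      = Riem2 G i k z + (E z * (if i = k then 1 else 0) + \<tau> k z * snd z $ i)"
    using projective_change_Riem2[OF G P eq] by blast
  have R: "hom 2 (R_scalar G)"
    unfolding R_scalar_def[abs_def] by (intro hom_cmult hom_sum hom_Riem2 G)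
  show ?thesis
  proof (rule isotropic_of_scalar_curvature[OF n G' _ _ _ chi])
    show "hom 2 (\<lambda>z. R_scalar G z + E z)" by (intro hom_add R E)
    show "hom 1 (\<lambda>z. \<tau> k z - 1 / 2 * dy k (R_scalar G) z)" for k
      by (intro hom_diff hom_cmult hom_dy[OF R] \<tau>) simp
    show "Riem2 G' i k z = (R_scalar G z + E z) * (if i = k then 1 else 0)
        + (\<tau> k z - 1 / 2 * dy k (R_scalar G) z) * snd z $ i" if "z \<in> S" for z i k
      using iso that by (simp add: R' isotropic_on_def algebra_simps)
  qed
qed

text \<open>Here \<open>\<psi>\<close> stands for the components of a change of coordinates, and \<open>G\<close> for the spray that it
  carries to the flat one.\<close>

lemma Riem_flat:
  assumes G: "spray_on G" and \<psi>: "\<And>a. smooth_on S (\<psi> a)"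
    and \<psi>_y: "\<And>a j z. z \<in> S \<Longrightarrow> dy j (\<psi> a) z = 0"
    and inj: "\<And>z w. z \<in> S \<Longrightarrow> (\<And>a :: 'b. (\<Sum>i\<in>UNIV. dx i (\<psi> a) z * w i) = 0) \<Longrightarrow> \<forall>i. w i = (0 :: real)"
    and G_eq: "\<And>a z. z \<in> S \<Longrightarrow> 2 * (\<Sum>i\<in>UNIV. dx i (\<psi> a) z * G z $ i)
      = (\<Sum>i\<in>UNIV. \<Sum>j\<in>UNIV. snd z $ i * snd z $ j * dx i (dx j (\<psi> a)) z)"
    and z: "z \<in> S"
  shows "Riem G i j k l z = 0"
proof -
  note sm [simp] = \<psi> hom_smooth[OF hom_N[OF G]] hom_smooth[OF hom_Gamma[OF G]]
  have Gs [simp]: "smooth_on S (\<lambda>w. G w $ i)" for i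
    using G by (auto simp: spray_on_def intro: hom_smooth)
  have \<psi>1: "dy j (dx i (\<psi> a)) w = 0" if w: "w \<in> S" for a i j w
  proof -
    have "dx i (dy j (\<psi> a)) w = dx i (\<lambda>_. 0) w"
      using w by (rule dx_cong) (rule \<psi>_y)
    then show ?thesis using w by (simp add: dx_dy_commute)
  qed
  have \<psi>2: "dy j (dx k (dx i (\<psi> a))) w = 0" if w: "w \<in> S" for a i j k w
  proof -
    have "dx k (dy j (dx i (\<psi> a))) w = dx k (\<lambda>_. 0) w"
      using w by (rule dx_cong) (rule \<psi>1)
    then show ?thesis using w by (simp add: dx_dy_commute)
  qed
  \<comment> \<open>Derivatives of \<open>\<psi>\<close> do not depend on y, so a y-derivative of
    \<open>G_eq\<close> acts only on \<open>G\<close> and on the explicit factors y. The two halves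
    of the quadratic form agree by symmetry of second derivatives.\<close>
  have N: "(\<Sum>i\<in>UNIV. dx i (\<psi> a) w * N_conn G i k w)
      = (\<Sum>j\<in>UNIV. snd w $ j * dx k (dx j (\<psi> a)) w)" if w: "w \<in> S" for a k w
  proof -
    have "2 * (\<Sum>i\<in>UNIV. dx i (\<psi> a) w * N_conn G i k w)
        = dy k (\<lambda>w. 2 * (\<Sum>i\<in>UNIV. dx i (\<psi> a) w * G w $ i)) w"
      using w by (simp add: \<psi>1 N_conn_def)
    also have "\<dots> = dy k (\<lambda>z.
        \<Sum>i\<in>UNIV. \<Sum>j\<in>UNIV. snd z $ i * snd z $ j * dx i (dx j (\<psi> a)) z) w"
      using w by (rule dy_cong) (rule G_eq)
    also have "\<dots> = (\<Sum>i\<in>UNIV. snd w $ i * dx i (dx k (\<psi> a)) w)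
        + (\<Sum>j\<in>UNIV. snd w $ j * dx k (dx j (\<psi> a)) w)"
    proof -
      have *: "(\<Sum>i\<in>UNIV. \<Sum>j\<in>UNIV. (if k = i then 1 else 0) * c i j) = (\<Sum>j\<in>UNIV. c k j)"
        for c :: "'n \<Rightarrow> 'n \<Rightarrow> real"
        by (subst sum.swap) (simp add: if_distrib[of "\<lambda>a. a * _"] cong: if_cong)
      have **: "(\<Sum>i\<in>UNIV. \<Sum>j\<in>UNIV. c i j * (if k = j then 1 else 0)) = (\<Sum>i\<in>UNIV. c i k)"
        for c :: "'n \<Rightarrow> 'n \<Rightarrow> real"
        by (simp add: if_distrib[of "\<lambda>a. _ * a"] cong: if_cong)
      have "dy k (\<lambda>z. \<Sum>i\<in>UNIV. \<Sum>j\<in>UNIV. snd z $ i * snd z $ j * dx i (dx j (\<psi> a)) z) w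
        = (\<Sum>i\<in>UNIV. \<Sum>j\<in>UNIV. (snd w $ i * dx i (dx j (\<psi> a)) w) * (if k = j then 1 else 0)
           + (if k = i then 1 else 0) * (snd w $ j * dx i (dx j (\<psi> a)) w))"
        using w by (simp add: \<psi>2 distrib_right mult_ac)
      then show ?thesis by (simp only: sum.distrib * **)
    qed
    also have "\<dots> = 2 * (\<Sum>j\<in>UNIV. snd w $ j * dx k (dx j (\<psi> a)) w)"
      using w by (simp add: dx_dx_commute[of w "\<psi> a" k])
    finally show ?thesis by simp
  qed
  have Gam: "(\<Sum>i\<in>UNIV. dx i (\<psi> a) w * Gamma_conn G i j k w) = dx k (dx j (\<psi> a)) w"
    if w: "w \<in> S" for a j k w
  proof -
    have "(\<Sum>i\<in>UNIV. dx i (\<psi> a) w * Gamma_conn G i j k w)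
        = dy j (\<lambda>w. \<Sum>i\<in>UNIV. dx i (\<psi> a) w * N_conn G i k w) w"
      using w by (simp add: \<psi>1 Gamma_conn_alt)
    also have "\<dots> = dy j (\<lambda>w. \<Sum>j\<in>UNIV. snd w $ j * dx k (dx j (\<psi> a)) w) w"
      using w by (rule dy_cong) (rule N)
    also have "\<dots> = dx k (dx j (\<psi> a)) w"
      using w by (simp add: \<psi>2 if_distrib[of "\<lambda>a. a * _"] cong: if_cong)
    finally show ?thesis .
  qed
  \<comment> \<open>One more y-derivative annihilates the right side of \<open>Gam\<close>. By
    injectivity of the Jacobian the coefficients are independent of y, so \<open>horiz_deriv\<close>
    reduces to \<open>dx\<close> on them.\<close>
  have Gam_y: "dy m (Gamma_conn G i j k) z = 0" for i j k m
  proof -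
    have "(\<Sum>i\<in>UNIV. dx i (\<psi> a) z * dy m (Gamma_conn G i j k) z) = 0" for a
    proof -
      have "(\<Sum>i\<in>UNIV. dx i (\<psi> a) z * dy m (Gamma_conn G i j k) z)
          = dy m (\<lambda>w. \<Sum>i\<in>UNIV. dx i (\<psi> a) w * Gamma_conn G i j k w) z"
        using z by (simp add: \<psi>1)
      also have "\<dots> = dy m (dx k (dx j (\<psi> a))) z"
        using z by (rule dy_cong) (rule Gam)
      finally show ?thesis using z by (simp add: \<psi>2)
    qed
    then show ?thesis using inj[OF z, of "\<lambda>i. dy m (Gamma_conn G i j k) z"] by blast
  qed
  have Gam_x: "(\<Sum>i\<in>UNIV. dx i (\<psi> a) z * dx l (Gamma_conn G i j k) z)
      = dx l (dx k (dx j (\<psi> a))) z - (\<Sum>i\<in>UNIV. dx l (dx i (\<psi> a)) z * Gamma_conn G i j k z)"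
    for a j k l
  proof -
    have "dx l (\<lambda>w. \<Sum>i\<in>UNIV. dx i (\<psi> a) w * Gamma_conn G i j k w) z = dx l (dx k (dx j (\<psi> a))) z"
      using z by (rule dx_cong) (rule Gam)
    then show ?thesis using z by (simp add: sum.distrib)
  qed
  \<comment> \<open>The Jacobian is absorbed into one factor through \<open>Gam\<close>; the result
    matches the correction term in \<open>Gam_x\<close>.\<close>
  have quad: "(\<Sum>i\<in>UNIV. dx i (\<psi> a) z * (\<Sum>s\<in>UNIV. Gamma_conn G s j l z * Gamma_conn G i k s z))
      = (\<Sum>i\<in>UNIV. dx k (dx i (\<psi> a)) z * Gamma_conn G i j l z)" for a j k l
    using z by (subst sum_mult_swap) (simp add: Gam dx_dx_commute[of z "\<psi> a" k] mult.commute)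
  have "(\<Sum>i\<in>UNIV. dx i (\<psi> a) z * Riem G i j k l z) = 0" for a
  proof -
    have "(\<Sum>i\<in>UNIV. dx i (\<psi> a) z * Riem G i j k l z)
      = (\<Sum>i\<in>UNIV. dx i (\<psi> a) z * dx k (Gamma_conn G i j l) z)
       - (\<Sum>i\<in>UNIV. dx i (\<psi> a) z * dx l (Gamma_conn G i j k) z)
       + (\<Sum>i\<in>UNIV. dx i (\<psi> a) z * (\<Sum>s\<in>UNIV. Gamma_conn G s j l z * Gamma_conn G i k s z))
       - (\<Sum>i\<in>UNIV. dx i (\<psi> a) z * (\<Sum>s\<in>UNIV. Gamma_conn G s j k z * Gamma_conn G i l s z))"
      unfolding Riem_def horiz_deriv_def
      by (simp add: Gam_y right_diff_distrib distrib_left sum_subtractf sum.distrib mult.commute)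
    \<comment> \<open>The quadratic terms cancel these corrections, and only a commutator of
      x-derivatives remains.\<close>
    also have "\<dots> = dx k (dx l (dx j (\<psi> a))) z - dx l (dx k (dx j (\<psi> a))) z"
      unfolding quad Gam_x by simp
    finally show ?thesis using z by (simp add: dx_dx_commute[of z "dx j (\<psi> a)" k])
  qed
  then show ?thesis using inj[OF z, of "\<lambda>i. Riem G i j k l z"] by blast
qed

lemma isotropic_on_of_Riem_zero:
  assumes "\<And>z i j k l. z \<in> S \<Longrightarrow> Riem G i j k l z = 0"
  shows "isotropic_on G"
proof -
  have R2: "Riem2 G i k z = 0" if "z \<in> S" for i k z
    using assms that by (simp add: Riem2_def)
  then have R: "R_scalar G z = 0" if "z \<in> S" for z
    using that by (simp add: R_scalar_def)
  have "dy k (R_scalar G) z = dy k (\<lambda>_. 0) z" if "z \<in> S" for k z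
    using that by (rule dy_cong) (rule R)
  then show ?thesis by (simp add: isotropic_on_def R R2)
qed

end

section \<open>Passage to the manifold\<close>

text \<open>For a transition map this is the change between the induced coordinates (x, y) of two
  charts.\<close>

definition tangent_map :: "('e::euclidean_space \<Rightarrow> 'e) \<Rightarrow> 'e \<times> 'e \<Rightarrow> 'e \<times> 'e" where
  "tangent_map f w = (f (fst w), frechet_derivative f (at (fst w)) (snd w))"

lemma smooth_on_compose_fst:
  fixes f :: "'e::euclidean_space \<Rightarrow> 'b::euclidean_space"
  assumes "open T" "smooth_on U f" "fst ` T \<subseteq> U"
  shows "smooth_on T (\<lambda>w :: 'e \<times> 'e. f (fst w))"
  using smooth_on_compose[OF assms(1,2) smooth_on_linear[OF assms(1) bounded_linear_fst]] assms(3)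
  by blast

lemma smooth_on_tangent_map:
  fixes f :: "'e::euclidean_space \<Rightarrow> 'e"
  assumes T: "open T" "fst ` T \<subseteq> U" and f: "smooth_on U f"
  shows "smooth_on T (tangent_map f)"
proof (rule smooth_on_cong[OF T(1)])
  show "smooth_on T (\<lambda>w. (f (fst w),
      \<Sum>b\<in>Basis. (snd w \<bullet> b) *\<^sub>R frechet_derivative f (at (fst w)) b))"
    using T f
    by (intro smooth_on_Pair smooth_on_sum smooth_on_scaleR smooth_on_compose_fst[of T U]
        smooth_on_derivative smooth_on_linear[OF T(1)
          bounded_linear_compose[OF bounded_linear_inner_left bounded_linear_snd]]) auto
  show "(f (fst w), \<Sum>b\<in>Basis. (snd w \<bullet> b) *\<^sub>R frechet_derivative f (at (fst w)) b)
      = tangent_map f w" if "w \<in> T" for w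
    using derivative_basis_expansion[OF smooth_on_differentiable[OF f], of "fst w" "snd w"] T that
    by (auto simp: tangent_map_def)
qed

lemma slit_domain_times:
  assumes "open (U :: (real^'n::finite) set)"
  shows "slit_domain (U \<times> - {0})"
  using assms by unfold_locales (auto intro: open_Times)

lemma slit_domain_slit_region:
  fixes A :: "('a, real^'n::finite) chart set"
  assumes "smooth_manifold M A" "c \<in> A"
  shows "slit_domain (slit_region c)"
  using assms unfolding slit_region_def
  by (intro slit_domain_times) (auto simp: smooth_manifold_def is_chart_def)

lemma spray_on_spray_coeff:
  fixes A :: "('a, real^'n::finite) chart set"
  assumes X: "is_spray A X" and c: "c \<in> A" and S: "slit_domain S" "S \<subseteq> slit_region c"
  shows "slit_domain.spray_on S (spray_coeff A X c)"
proof -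
  interpret slit_domain S by fact
  have sm: "smooth_on S (spray_coeff A X c)" and h: "pos_homogeneous c 2 (spray_coeff A X c)"
    using X c S(2) by (auto simp: is_spray_def intro: smooth_on_subset)
  have "hom (real 2) (\<lambda>z. spray_coeff A X c z $ i)" for i
  proof (rule hom_of_homogeneous)
    show "smooth_on S (\<lambda>z. spray_coeff A X c z $ i)"
      by (rule smooth_on_bounded_linear[OF open_S bounded_linear_vec_nth sm])
    show "spray_coeff A X c (x, t *\<^sub>R y) $ i = t ^ 2 * spray_coeff A X c (x, y) $ i"
      if "(x, y) \<in> S" "t > 0" for x y t
      using h S(2) that unfolding pos_homogeneous_def by fastforce
  qed
  then show ?thesis by (simp add: spray_on_def)
qed

lemma isotropic_curvature_iff:
  fixes A :: "('a, real^'n::finite) chart set"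
  assumes M: "smooth_manifold M A"
  shows "isotropic_curvature A X
    \<longleftrightarrow> (\<forall>c\<in>A. slit_domain.isotropic_on (slit_region c) (spray_coeff A X c))"
  using slit_domain.isotropic_on_def[OF slit_domain_slit_region[OF M]]
  by (auto simp: isotropic_curvature_def Let_def)

section \<open>Non-zero tangent vectors in slit charts\<close>

lemma tangent_space_scaleR:
  assumes M: "smooth_manifold M A" and v: "v \<in> tangent_space A p"
  shows "(\<lambda>c. t *\<^sub>R v c) \<in> tangent_space A p"
proof -
  have "t *\<^sub>R v d = frechet_derivative (transition c d) (at (chart_map c p)) (t *\<^sub>R v c)"
    if "c \<in> A" "d \<in> A" "p \<in> chart_dom c" "p \<in> chart_dom d" for c d
  proof -
    have "v d = frechet_derivative (transition c d) (at (chart_map c p)) (v c)"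
      using v that unfolding tangent_space_def by blast
    then show ?thesis
      using linear_scale[OF linear_frechet_derivative[OF transition_differentiable[OF M that]]]
      by simp
  qed
  moreover have "t *\<^sub>R v c = 0" if "c \<notin> A \<or> p \<notin> chart_dom c" for c
  proof -
    have "v c = 0" using v that unfolding tangent_space_def by blast
    then show ?thesis by simp
  qed
  ultimately show ?thesis unfolding tangent_space_def by blast
qed

lemma chart_inv_slit_chart:
  assumes M: "smooth_manifold M A" and c: "c \<in> A" and z: "(x, y) \<in> slit_region c"
  obtains p v where "chart_inv (slit_chart A c) (x, y) = (p, v)" "p \<in> chart_dom c"
    "v \<in> tangent_space A p" "v \<noteq> (\<lambda>_. 0)" "chart_map c p = x" "v c = y"
proof -
  let ?f = "chart_map (slit_chart A c)" and ?D = "chart_dom (slit_chart A c)"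
  obtain p v where pv: "chart_inv (slit_chart A c) (x, y) = (p, v)" by fastforce
  have im: "(x, y) \<in> ?f ` ?D"
    using bij_betw_slit_chart[OF M c] z by (simp add: bij_betw_def)
  have "(p, v) \<in> ?D" "?f (p, v) = (x, y)"
    using inv_into_into[OF im] f_inv_into_f[OF im] pv by (auto simp: chart_inv_def)
  then show ?thesis
    using that[OF pv] by (auto simp: slit_chart_def slit_tangent_bundle_def)
qed

lemma chart_inv_slit_chart_eqI:
  assumes M: "smooth_manifold M A" and c: "c \<in> A" "p \<in> chart_dom c"
    and v: "v \<in> tangent_space A p" "v \<noteq> (\<lambda>_. 0)"
  shows "chart_inv (slit_chart A c) (chart_map c p, v c) = (p, v)"
proof -
  have "(p, v) \<in> chart_dom (slit_chart A c)"
    using c v by (auto simp: slit_chart_def slit_tangent_bundle_def)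
  from inv_into_f_f[OF bij_betw_imp_inj_on[OF bij_betw_slit_chart[OF M c(1)]] this]
  show ?thesis by (simp add: chart_inv_def slit_chart_def)
qed

text \<open>Translates homogeneity of a function on tangent vectors into homogeneity of its
  coordinate expression.\<close>

lemma chart_inv_slit_chart_scaleR:
  assumes M: "smooth_manifold M A" and c: "c \<in> A" and z: "(x, y) \<in> slit_region c" and t: "t > 0"
    and pv: "chart_inv (slit_chart A c) (x, y) = (p, v)"
  shows "chart_inv (slit_chart A c) (x, t *\<^sub>R y) = (p, \<lambda>c. t *\<^sub>R v c)"
proof -
  have *: "p \<in> chart_dom c" "v \<in> tangent_space A p" "v \<noteq> (\<lambda>_. 0)" "chart_map c p = x" "v c = y"
    by (rule chart_inv_slit_chart[OF M c z]; use pv in auto)+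
  then have "(\<lambda>c. t *\<^sub>R v c) \<noteq> (\<lambda>_. 0)"
    using t by (auto simp: fun_eq_iff)
  from chart_inv_slit_chart_eqI[OF M c *(1) tangent_space_scaleR[OF M *(2)] this] show ?thesis
    using * by simp
qed

text \<open>The projective factor changes sign.\<close>

lemma projectively_equivalent_sym:
  fixes A :: "('a, 'e::euclidean_space) chart set"
  assumes M: "smooth_manifold M A" and "projectively_equivalent A X1 X2"
  shows "projectively_equivalent A X2 X1"
proof -
  obtain P :: "'a \<times> ('a, 'e) tvec \<Rightarrow> real" where
    P: "\<And>p v t. (p, v) \<in> slit_tangent_bundle A \<Longrightarrow> t > 0 \<Longrightarrow> P (p, \<lambda>c. t *\<^sub>R v c) = t * P (p, v)"
    and sm: "\<And>c. c \<in> A \<Longrightarrow> smooth_on (slit_region c) (\<lambda>z. P (chart_inv (slit_chart A c) z))"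
    and eq: "\<And>c x y. c \<in> A \<Longrightarrow> (x, y) \<in> slit_region c \<Longrightarrow> spray_coeff A X1 c (x, y)
      = spray_coeff A X2 c (x, y) + P (chart_inv (slit_chart A c) (x, y)) *\<^sub>R y"
    using assms(2) unfolding projectively_equivalent_def by blast
  have "smooth_on (slit_region c) (\<lambda>z. - P (chart_inv (slit_chart A c) z))" if "c \<in> A" for c
  proof -
    have "open (slit_region c)"
      using M that by (auto simp: smooth_manifold_def is_chart_def slit_region_def intro: open_Times)
    from smooth_on_bounded_linear[OF this bounded_linear_minus[OF bounded_linear_ident] sm[OF that]]
    show ?thesis .
  qed
  then show ?thesis
    unfolding projectively_equivalent_def
    by (intro exI[of _ "\<lambda>q. - P q"]) (use P eq in auto)
qed

text \<open>One implication of the equivalence, obtained chart by chart: the global factor is read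
  in slit coordinates, where its scaling law becomes Euler's identity.\<close>

lemma isotropic_curvature_projective:
  fixes A :: "('a, real^'n::finite) chart set"
  assumes M: "smooth_manifold M A" and n: "CARD('n) \<ge> 2" and X2: "is_spray A X2"
    and proj: "projectively_equivalent A X1 X2" and chi: "vanishing_chi A X1"
    and iso: "isotropic_curvature A X2"
  shows "isotropic_curvature A X1"
  unfolding isotropic_curvature_iff[OF M]
proof
  fix c assume c: "c \<in> A"
  interpret slit_domain "slit_region c" by (rule slit_domain_slit_region[OF M c])
  obtain P where
    P: "\<And>p v t. (p, v) \<in> slit_tangent_bundle A \<Longrightarrow> t > 0 \<Longrightarrow> P (p, \<lambda>c. t *\<^sub>R v c) = t * P (p, v)"
    and sm: "smooth_on (slit_region c) (\<lambda>z. P (chart_inv (slit_chart A c) z))"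
    and eq: "\<And>x y. (x, y) \<in> slit_region c \<Longrightarrow> spray_coeff A X1 c (x, y)
      = spray_coeff A X2 c (x, y) + P (chart_inv (slit_chart A c) (x, y)) *\<^sub>R y"
    using proj c unfolding projectively_equivalent_def by blast
  have "hom (real 1) (\<lambda>z. P (chart_inv (slit_chart A c) z))"
  proof (rule hom_of_homogeneous[OF sm])
    fix x y and t :: real assume z: "(x, y) \<in> slit_region c" and t: "t > 0"
    obtain p v where pv: "chart_inv (slit_chart A c) (x, y) = (p, v)"
      and q: "p \<in> chart_dom c" "v \<in> tangent_space A p" "v \<noteq> (\<lambda>_. 0)"
      using chart_inv_slit_chart[OF M c z] by metis
    then have "(p, v) \<in> slit_tangent_bundle A"
      using c by (auto simp: slit_tangent_bundle_def)
    then show "P (chart_inv (slit_chart A c) (x, t *\<^sub>R y)) = t ^ 1 * P (chart_inv (slit_chart A c) (x, y))"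
      using P[OF _ t] by (simp add: chart_inv_slit_chart_scaleR[OF M c z t pv] pv)
  qed
  then have homP: "hom 1 (\<lambda>z. P (chart_inv (slit_chart A c) z))" by simp
  show "isotropic_on (spray_coeff A X1 c)"
  proof (rule isotropic_on_projective_change[OF n _ _ homP])
    show "spray_on (spray_coeff A X2 c)"
      by (rule spray_on_spray_coeff[OF X2 c slit_domain_axioms order_refl])
    show "isotropic_on (spray_coeff A X2 c)"
      using iso c unfolding isotropic_curvature_iff[OF M] by blast
    show "chi_curv (spray_coeff A X1 c) k z = 0" if "z \<in> slit_region c" for z k
      using chi c that by (simp add: vanishing_chi_def)
    show "spray_coeff A X1 c w = spray_coeff A X2 c w + P (chart_inv (slit_chart A c) w) *\<^sub>R snd w"
      if "w \<in> slit_region c" for w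
      using eq[of "fst w" "snd w"] that by simp
  qed
qed

section \<open>Sprays under a change of coordinates and flat charts\<close>

text \<open>A spray is a vector field on the slit tangent bundle, so its components in two slit
  charts are related by the Jacobian of their transition map, and that map is the tangent map of the
  base transition.\<close>

lemma spray_coeff_transition:
  fixes A :: "('a, 'e::euclidean_space) chart set"
  assumes M: "smooth_manifold M A" and c: "c \<in> A" and d: "d \<in> A" and X: "is_spray A X"
    and w: "w \<in> chart_map d ` (chart_dom d \<inter> chart_dom c) \<times> - {0}"
  shows "tangent_map (transition d c) w \<in> slit_region c"
    and "frechet_derivative (tangent_map (transition d c)) (at w) (snd w, - 2 *\<^sub>R spray_coeff A X d w)
      = (snd (tangent_map (transition d c) w),
         - 2 *\<^sub>R spray_coeff A X c (tangent_map (transition d c) w))"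
proof -
  let ?T = "chart_map d ` (chart_dom d \<inter> chart_dom c) \<times> - {0 :: 'e}"
  have ch: "is_chart M c" "is_chart M d" using M c d by (auto simp: smooth_manifold_def)
  have T: "open ?T" "?T \<subseteq> slit_region d"
    using open_chart_overlap[OF ch(2,1)] by (auto intro: open_Times simp: slit_region_def chart_image_def)
  \<comment> \<open>Every coordinate pair over the overlap belongs to a single tangent vector seen
    by both slit charts. This is needed on all of \<open>?T\<close>, since derivatives at
    \<open>w\<close> are compared below.\<close>
  have *: "\<exists>p v. chart_inv (slit_chart A d) u = (p, v) \<and> (p, v) \<in> chart_dom (slit_chart A d)
      \<and> (p, v) \<in> chart_dom (slit_chart A c) \<and> u = chart_map (slit_chart A d) (p, v)
      \<and> tangent_map (transition d c) u = chart_map (slit_chart A c) (p, v)"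
    if u: "u \<in> ?T" for u
  proof -
    obtain x y where xy: "u = (x, y)" by fastforce
    have "(x, y) \<in> slit_region d" using u T xy by blast
    from chart_inv_slit_chart[OF M d this] obtain p v where
      pv: "chart_inv (slit_chart A d) (x, y) = (p, v)" "p \<in> chart_dom d" "v \<in> tangent_space A p"
        "v \<noteq> (\<lambda>_. 0)" "chart_map d p = x" "v d = y" by metis
    have inv: "chart_inv d x = p" using chart_inv_chart_map[OF ch(2)] pv by blast
    have p: "p \<in> chart_dom c"
    proof -
      obtain q where "q \<in> chart_dom d" "q \<in> chart_dom c" "chart_map d q = x"
        using u xy by auto
      then show ?thesis using chart_inv_chart_map[OF ch(2)] inv by metis
    qed
    have "v c = frechet_derivative (transition d c) (at (chart_map d p)) (v d)"
      using pv p c d unfolding tangent_space_def by blast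
    then have "tangent_map (transition d c) u = (chart_map c p, v c)"
      using pv inv xy by (simp add: tangent_map_def transition_def)
    then show ?thesis
      using pv p c d xy by (auto simp: slit_chart_def slit_tangent_bundle_def)
  qed
  obtain p v where pv: "chart_inv (slit_chart A d) w = (p, v)" "(p, v) \<in> chart_dom (slit_chart A d)"
    "(p, v) \<in> chart_dom (slit_chart A c)" "w = chart_map (slit_chart A d) (p, v)"
    "tangent_map (transition d c) w = chart_map (slit_chart A c) (p, v)"
    using *[OF w] by blast
  have bij: "bij_betw (chart_map (slit_chart A c)) (chart_dom (slit_chart A c)) (slit_region c)"
    by (rule bij_betw_slit_chart[OF M c])
  show region: "tangent_map (transition d c) w \<in> slit_region c"
    using bij_betwE[OF bij] pv by auto
  have inv_c: "chart_inv (slit_chart A c) (tangent_map (transition d c) w) = (p, v)"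
    using inv_into_f_f[OF bij_betw_imp_inj_on[OF bij] pv(3)] by (simp add: chart_inv_def pv(5))
  have spray: "X (chart_inv (slit_chart A e) u) (slit_chart A e) = (snd u, - 2 *\<^sub>R spray_coeff A X e u)"
    if "e \<in> A" "u \<in> slit_region e" for e u
    using X that unfolding is_spray_def by (cases u) auto
  have Xd: "X (p, v) (slit_chart A d) = (snd w, - 2 *\<^sub>R spray_coeff A X d w)"
    using spray[OF d, of w] T w by (auto simp: pv(1))
  have Xc: "X (p, v) (slit_chart A c) = (snd (tangent_map (transition d c) w),
      - 2 *\<^sub>R spray_coeff A X c (tangent_map (transition d c) w))"
    using spray[OF c region] by (simp add: inv_c)
  have atlas: "slit_chart A c \<in> slit_atlas A" "slit_chart A d \<in> slit_atlas A"
    using c d by (auto simp: slit_atlas_def)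
  have "X (p, v) \<in> tangent_space (slit_atlas A) (p, v)"
    using X pv(3) atlas unfolding is_spray_def smooth_vector_field_def by blast
  then have "X (p, v) (slit_chart A c)
      = frechet_derivative (transition (slit_chart A d) (slit_chart A c)) (at w) (X (p, v) (slit_chart A d))"
    using pv(2-4) atlas unfolding tangent_space_def by blast
  also have "frechet_derivative (transition (slit_chart A d) (slit_chart A c)) (at w)
      = frechet_derivative (tangent_map (transition d c)) (at w)"
    using * by (intro frechet_derivative_cong_open[OF T(1) w]) (force simp: transition_def)
  finally show "frechet_derivative (tangent_map (transition d c)) (at w)
      (snd w, - 2 *\<^sub>R spray_coeff A X d w)
    = (snd (tangent_map (transition d c) w),
       - 2 *\<^sub>R spray_coeff A X c (tangent_map (transition d c) w))"
    unfolding Xd Xc by (rule sym)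
qed

text \<open>Over the overlap with a flat chart, subtracting the pulled-back projective factor leaves
  the flat spray in the coordinates of \<open>d\<close>. Its curvature vanishes by
  \<open>Riem_flat\<close>, and the given spray is a projective change of it with vanishing
  chi.\<close>

lemma isotropic_near_flat_chart:
  fixes A :: "('a, real^'n::finite) chart set"
  assumes M: "smooth_manifold M A" and n: "CARD('n) \<ge> 2" and c: "c \<in> A" and d: "d \<in> A"
    and X: "is_spray A X" and chi: "vanishing_chi A X"
    and P: "smooth_on (slit_region c) P" "pos_homogeneous c 1 P"
    and flat: "\<And>x y. (x, y) \<in> slit_region c \<Longrightarrow> spray_coeff A X c (x, y) = P (x, y) *\<^sub>R y"
  shows "slit_domain.isotropic_on (chart_map d ` (chart_dom d \<inter> chart_dom c) \<times> - {0})
    (spray_coeff A X d)"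
proof -
  let ?U = "chart_map d ` (chart_dom d \<inter> chart_dom c)"
  let ?S = "?U \<times> - {0 :: real^'n}"
  let ?G = "spray_coeff A X d"
  define \<psi> where "\<psi> = transition d c"
  define Q where "Q w = P (tangent_map \<psi> w)" for w
  \<comment> \<open>Components of the coordinate change, lifted to functions of (x, y) that are
    constant in y.\<close>
  define f where "f a w = \<psi> (fst w) $ a" for a and w :: "(real^'n) \<times> (real^'n)"
  define G0 where "G0 w = ?G w - Q w *\<^sub>R snd w" for w
  have ch: "is_chart M c" "is_chart M d" using M c d by (auto simp: smooth_manifold_def)
  interpret slit_domain ?S
    by (rule slit_domain_times[OF open_chart_overlap[OF ch(2,1)]])
  have sub: "?S \<subseteq> slit_region d" by (auto simp: slit_region_def chart_image_def)
  have "smooth_on (chart_map d ` (chart_dom c \<inter> chart_dom d)) (transition d c)"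
    using M c d by (auto simp: smooth_manifold_def smoothly_compatible_def)
  then have \<psi>: "smooth_on ?U \<psi>" by (simp add: \<psi>_def Int_commute)
  have T: "smooth_on ?S (tangent_map \<psi>)"
    by (rule smooth_on_tangent_map[OF open_S _ \<psi>]) auto
  have region: "tangent_map \<psi> w \<in> slit_region c" if "w \<in> ?S" for w
    unfolding \<psi>_def by (rule spray_coeff_transition(1)[OF M c d X that])
  have lin: "linear (frechet_derivative \<psi> (at x))" if "x \<in> ?U" for x
    by (rule linear_frechet_derivative[OF smooth_on_differentiable[OF \<psi> that]])
  have "hom (real 1) Q"
  proof (rule hom_of_homogeneous)
    show "smooth_on ?S Q"
      unfolding Q_def[abs_def] by (rule smooth_on_compose[OF open_S P(1) T region])
    show "Q (x, t *\<^sub>R y) = t ^ 1 * Q (x, y)" if xy: "(x, y) \<in> ?S" and t: "t > 0" for x y t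
    proof -
      have "tangent_map \<psi> (x, t *\<^sub>R y)
          = (fst (tangent_map \<psi> (x, y)), t *\<^sub>R snd (tangent_map \<psi> (x, y)))"
        using linear_scale[OF lin] xy by (simp add: tangent_map_def)
      then show ?thesis
        using P(2) region[OF xy] t unfolding pos_homogeneous_def Q_def
        by (cases "tangent_map \<psi> (x, y)") auto
    qed
  qed
  then have Q: "hom 1 Q" by simp
  have G: "spray_on ?G"
    by (rule spray_on_spray_coeff[OF X d slit_domain_axioms sub])
  have G0: "spray_on G0"
    using G unfolding spray_on_def G0_def
    by (auto intro!: hom_diff hom_mult[OF Q hom_snd])
  have f: "smooth_on ?S (f a)" for a
    unfolding f_def[abs_def]
    by (rule smooth_on_bounded_linear[OF open_S bounded_linear_vec_nth
          smooth_on_compose_fst[OF open_S \<psi>]]) auto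
  have Df: "frechet_derivative (f a) (at w) (u, v) = frechet_derivative \<psi> (at (fst w)) u $ a"
    if w: "w \<in> ?S" for a w u v
  proof -
    have "\<psi> differentiable (at (fst w))"
      using w smooth_on_differentiable[OF \<psi>] by auto
    then have "((\<lambda>w. \<psi> (fst w)) has_derivative (\<lambda>v. frechet_derivative \<psi> (at (fst w)) (fst v))) (at w)"
      by (intro has_derivative_compose[OF has_derivative_fst[OF has_derivative_ident]])
         (simp only: frechet_derivative_works)
    from bounded_linear.has_derivative[OF bounded_linear_vec_nth this]
    have "(f a has_derivative (\<lambda>v. frechet_derivative \<psi> (at (fst w)) (fst v) $ a)) (at w)"
      by (simp add: f_def[abs_def])
    from fun_cong[OF frechet_derivative_at[OF this], of "(u, v)"] show ?thesis by simp
  qed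
  have f_y: "dy j (f a) w = 0" if w: "w \<in> ?S" for a j w
    using linear_0[OF lin] w by (auto simp: dy_def Df[OF w])
  have f_xy: "dy j (dx i (f a)) w = 0" if w: "w \<in> ?S" for a i j w
  proof -
    have "dx i (dy j (f a)) w = dx i (\<lambda>_. 0) w"
      using w by (rule dx_cong) (rule f_y)
    then show ?thesis using w f by (simp add: dx_dy_commute)
  qed
  have D\<psi>: "frechet_derivative \<psi> (at (fst w)) u $ a = (\<Sum>i\<in>UNIV. u $ i * dx i (f a) w)"
    if w: "w \<in> ?S" for a u w
    using derivative_components[OF smooth_on_differentiable[OF f[of a] w], of u 0] Df[OF w, of a u 0]
    by simp
  have "Riem G0 i j k l w = 0" if "w \<in> ?S" for i j k l w
  proof (rule Riem_flat[OF G0 f f_y _ _ that])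
    fix w and b :: "'n \<Rightarrow> real"
    assume w: "w \<in> ?S" and b: "\<And>a. (\<Sum>i\<in>UNIV. dx i (f a) w * b i) = 0"
    have "fst w \<in> ?U" using w by auto
    then obtain p where p: "p \<in> chart_dom d" "p \<in> chart_dom c" "fst w = chart_map d p"
      by blast
    have "frechet_derivative \<psi> (at (fst w)) (\<chi> i. b i) = 0"
      using b by (simp add: vec_eq_iff D\<psi>[OF w] mult.commute)
    \<comment> \<open>The Jacobian of the opposite transition inverts that of \<open>\<psi>\<close>,
      by the cocycle rule.\<close>
    then have "(\<chi> i. b i) = frechet_derivative (transition c d) (at (chart_map c p)) 0"
      using transition_derivative_cocycle[OF M d c d p(1,2,1), of "\<chi> i. b i"]
        transition_self_derivative[OF M d p(1)] by (simp add: \<psi>_def p(3))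
    also have "\<dots> = 0"
      by (rule linear_0[OF linear_frechet_derivative[OF transition_differentiable[OF M c d p(2,1)]]])
    finally show "\<forall>i. b i = 0" by (simp add: vec_eq_iff)
  next
    fix a w assume w: "w \<in> ?S"
    \<comment> \<open>The \<open>a\<close>-th fibre component of the tangent map; differentiating it
      along the spray yields the \<open>a\<close>-th vertical component of the transformation
      law.\<close>
    define h where "h w = (\<Sum>j\<in>UNIV. snd w $ j * dx j (f a) w)" for w
    have h_eq: "snd (tangent_map \<psi> u) $ a = h u" if "u \<in> ?S" for u
      using D\<psi>[OF that] by (simp add: tangent_map_def h_def)
    have h: "smooth_on ?S h" using f by (simp add: h_def[abs_def])
    have dh: "dx i h w = (\<Sum>j\<in>UNIV. snd w $ j * dx i (dx j (f a)) w)" "dy i h w = dx i (f a) w" for i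
      using w f by (simp_all add: h_def[abs_def] f_xy if_distrib[of "\<lambda>x. x * _"] cong: if_cong)
    have Td: "tangent_map \<psi> differentiable (at w)" by (rule smooth_on_differentiable[OF T w])
    have Sd: "((\<lambda>u. snd (tangent_map \<psi> u)) has_derivative
        (\<lambda>v. snd (frechet_derivative (tangent_map \<psi>) (at w) v))) (at w)"
      using Td by (intro has_derivative_snd) (simp only: frechet_derivative_works)
    let ?v = "(snd w, - 2 *\<^sub>R ?G w)"
    have "frechet_derivative h (at w) ?v
        = frechet_derivative (\<lambda>u. snd (tangent_map \<psi> u) $ a) (at w) ?v"
      using frechet_derivative_cong_open[OF open_S w, of h "\<lambda>u. snd (tangent_map \<psi> u) $ a"] h_eq by simp
    also have "\<dots> = snd (frechet_derivative (tangent_map \<psi>) (at w) ?v) $ a"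
      using fun_cong[OF frechet_derivative_at[OF bounded_linear.has_derivative[OF
            bounded_linear_vec_nth Sd]], of ?v] by simp
    also have "\<dots> = - 2 * spray_coeff A X c (tangent_map \<psi> w) $ a"
      using spray_coeff_transition(2)[OF M c d X w] by (simp add: \<psi>_def)
    also have "\<dots> = - 2 * Q w * h w"
      using flat[of "fst (tangent_map \<psi> w)" "snd (tangent_map \<psi> w)"] region[OF w] h_eq[OF w]
      by (simp add: Q_def)
    finally have "(\<Sum>i\<in>UNIV. snd w $ i * dx i h w) - 2 * (\<Sum>i\<in>UNIV. ?G w $ i * dx i (f a) w)
        = - 2 * Q w * h w"
      unfolding derivative_components[OF smooth_on_differentiable[OF h w]]
      by (simp add: dh sum_distrib_left sum_negf mult.assoc)
    \<comment> \<open>With \<open>G0\<close> in place of \<open>?G\<close>, the y-multiple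
      contributes \<open>2 * Q w * h w\<close> and cancels the right side.\<close>
    then show "2 * (\<Sum>i\<in>UNIV. dx i (f a) w * G0 w $ i)
        = (\<Sum>i\<in>UNIV. \<Sum>j\<in>UNIV. snd w $ i * snd w $ j * dx i (dx j (f a)) w)"
      by (simp add: G0_def h_def dh algebra_simps sum_subtractf sum_negf sum_distrib_left)
  qed
  then have iso: "isotropic_on G0" by (rule isotropic_on_of_Riem_zero)
  have chi_d: "chi_curv ?G k w = 0" if "w \<in> ?S" for k w
    using chi d sub that unfolding vanishing_chi_def by blast
  show "isotropic_on ?G"
    by (rule isotropic_on_projective_change[OF n G0 iso Q _ chi_d]) (simp add: G0_def)
qed

theorem theorem1p3:
  fixes M :: "'a topology" and A :: "('a, real^'n::finite) chart set"
  assumes "smooth_manifold M A"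
    and "CARD('n) \<ge> 2"
  shows "(\<forall>G1 G2. is_spray A G1 \<and> is_spray A G2 \<and> projectively_equivalent A G1 G2 \<and>
            vanishing_chi A G1 \<and> vanishing_chi A G2 \<longrightarrow>
            (isotropic_curvature A G1 \<longleftrightarrow> isotropic_curvature A G2)) \<and>
         (\<forall>G. is_spray A G \<and> locally_projectively_flat M A G \<and> vanishing_chi A G \<longrightarrow>
            isotropic_curvature A G)"
proof (intro conjI allI impI)
  show "isotropic_curvature A G1 \<longleftrightarrow> isotropic_curvature A G2"
    if "is_spray A G1 \<and> is_spray A G2 \<and> projectively_equivalent A G1 G2 \<and>
      vanishing_chi A G1 \<and> vanishing_chi A G2" for G1 G2
    using that isotropic_curvature_projective[OF assms] projectively_equivalent_sym[OF assms(1)]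
    by blast
next
  fix G assume G: "is_spray A G \<and> locally_projectively_flat M A G \<and> vanishing_chi A G"
  show "isotropic_curvature A G"
    unfolding isotropic_curvature_iff[OF assms(1)]
  proof
    fix d assume d: "d \<in> A"
    interpret d: slit_domain "slit_region d" by (rule slit_domain_slit_region[OF assms(1) d])
    have ch: "is_chart M c" if "c \<in> A" for c
      using assms(1) that by (auto simp: smooth_manifold_def)
    show "d.isotropic_on (spray_coeff A G d)"
      unfolding d.isotropic_on_def
    proof
      fix z assume z: "z \<in> slit_region d"
      then have "fst z \<in> chart_image d" by (auto simp: slit_region_def)
      then obtain p where p: "p \<in> chart_dom d" "fst z = chart_map d p"
        unfolding chart_image_def by blast
      then have "p \<in> topspace M"
        using assms(1) d by (auto simp: smooth_manifold_def)
      then obtain c P where c: "c \<in> A" "p \<in> chart_dom c" and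
        P: "smooth_on (slit_region c) P" "pos_homogeneous c 1 P"
        "\<And>x y. (x, y) \<in> slit_region c \<Longrightarrow> spray_coeff A G c (x, y) = P (x, y) *\<^sub>R y"
        using G unfolding locally_projectively_flat_def by blast
      \<comment> \<open>The curvature quantities at \<open>z\<close> do not refer to the ambient
        set, so isotropy proved over the overlap with a flat chart can be read off at
        \<open>z\<close>.\<close>
      let ?S = "chart_map d ` (chart_dom d \<inter> chart_dom c) \<times> - {0}"
      interpret S: slit_domain ?S
        by (rule slit_domain_times[OF open_chart_overlap[OF ch[OF d] ch[OF c(1)]]])
      have "S.isotropic_on (spray_coeff A G d)"
        using isotropic_near_flat_chart[OF assms c(1) d _ _ P] G by blast
      moreover have "z \<in> ?S"
        using z p c(2) by (cases z) (auto simp: slit_region_def)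
      ultimately show "\<forall>i k. Riem2 (spray_coeff A G d) i k z
          = R_scalar (spray_coeff A G d) z * (if i = k then 1 else 0)
            - 1 / 2 * dy k (R_scalar (spray_coeff A G d)) z * snd z $ i"
        unfolding S.isotropic_on_def by blast
    qed
  qed
qed

end
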